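(* The following decision problem is PSPACE-hard: given a finite set $G$ of matrices in $\mathrm{SL}(2,\mathbb{Z})$, generating the multiplicative semigroup $S$, and a positive integer $k$, decide whether every prime matrix in $S$ has at most $k$ different factorizations over $G$ (i.e. whether $S$ is $k$-free).
   Context: $\mathrm{SL}(2,\mathbb{Z})$ is the group of $2\times2$ integer matrices with determinant $1$. For a finite set $G$ of matrices, $S=\langle G\rangle$ denotes the semigroup of all finite nonempty products of elements of $G$. A factorization of $M\in S$ over $G$ is a finite nonempty sequence $(A_1,\dots,A_t)$ of elements of $G$ with $A_1A_2\cdots A_t=M$; two factorizations are different if they are different sequences. For $M\in S$, $\mathrm{dec}(M)$ denotes the number of different factorizations of $M$ over $G$. A matrix $M\in S$ is prime if it is impossible to write $M=M_1M_2$ with $M_1,M_2\in S$ such that $\mathrm{dec}(M)=\mathrm{dec}(M_1)\cdot\mathrm{dec}(M_2)$, $\mathrm{dec}(M_1)\neq1$ and $\mathrm{dec}(M_2)\neq1$. The semigroup $S$ is $k$-free if $\max\{\mathrm{dec}(M)\mid M\in S,\ M\text{ prime}\}\le k$. *)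

theory Defs
  imports
    "HOL-Analysis.Determinants"
    "HOL-Computational_Algebra.Polynomial"
    "HOL-Library.Extended_Nat"
begin

definition SL2Z :: "(int^2^2) set" where
  "SL2Z = {A. det A = 1}"

definition mat_prod :: "(int^2^2) list \<Rightarrow> int^2^2" where
  "mat_prod As = foldr (**) As (mat 1)"

definition factorizations :: "(int^2^2) set \<Rightarrow> int^2^2 \<Rightarrow> (int^2^2) list set" where
  "factorizations G M = {As. As \<noteq> [] \<and> set As \<subseteq> G \<and> mat_prod As = M}"

definition semigroup_gen :: "(int^2^2) set \<Rightarrow> (int^2^2) set" where
  "semigroup_gen G = {mat_prod As | As. As \<noteq> [] \<and> set As \<subseteq> G}"

text \<open>A matrix may have infinitely many factorizations (for instance if the generated semigroup
  contains the identity), so the number of factorizations is an extended natural number.\<close>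

definition dec :: "(int^2^2) set \<Rightarrow> int^2^2 \<Rightarrow> enat" where
  "dec G M = (if finite (factorizations G M) then enat (card (factorizations G M)) else \<infinity>)"

definition prime_matrix :: "(int^2^2) set \<Rightarrow> int^2^2 \<Rightarrow> bool" where
  "prime_matrix G M \<longleftrightarrow> M \<in> semigroup_gen G \<and>
     \<not> (\<exists>M1 \<in> semigroup_gen G. \<exists>M2 \<in> semigroup_gen G.
          M = M1 ** M2 \<and> dec G M = dec G M1 * dec G M2 \<and> dec G M1 \<noteq> 1 \<and> dec G M2 \<noteq> 1)"

definition k_free :: "(int^2^2) set \<Rightarrow> nat \<Rightarrow> bool" where
  "k_free G k \<longleftrightarrow> (\<forall>M. prime_matrix G M \<longrightarrow> dec G M \<le> enat k)"

text \<open>Machines have finitely many one-way infinite tapes. States and tape symbols are initial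
  segments of the natural numbers. State 0 is the start state; 1 and 2 are the accepting and the
  rejecting halting state. Symbol 0 is the blank; 1 and 2 represent the input bits.\<close>

datatype dir = MoveL | MoveN | MoveR

record tm =
  n_tapes :: nat
  n_states :: nat
  n_syms :: nat
  trans_fun :: "nat \<Rightarrow> nat list \<Rightarrow> nat \<times> (nat \<times> dir) list"

definition wf_tm :: "tm \<Rightarrow> bool" where
  "wf_tm M \<longleftrightarrow> n_tapes M \<ge> 1 \<and> n_states M \<ge> 3 \<and> n_syms M \<ge> 3 \<and>
     (\<forall>q rs q' as. q < n_states M \<longrightarrow> length rs = n_tapes M \<longrightarrow> set rs \<subseteq> {..<n_syms M} \<longrightarrow>
        trans_fun M q rs = (q', as) \<longrightarrow>
        q' < n_states M \<and> length as = n_tapes M \<and> fst ` set as \<subseteq> {..<n_syms M})"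

text \<open>A tape is its contents together with the head position. A left move in cell 0 leaves the
  head where it is.\<close>

type_synonym tape = "(nat \<Rightarrow> nat) \<times> nat"
type_synonym config = "nat \<times> tape list"

fun move_head :: "dir \<Rightarrow> nat \<Rightarrow> nat" where
  "move_head MoveL h = h - 1"
| "move_head MoveN h = h"
| "move_head MoveR h = Suc h"

fun tape_act :: "tape \<Rightarrow> nat \<times> dir \<Rightarrow> tape" where
  "tape_act (t, h) (s, d) = (t(h := s), move_head d h)"

fun tm_step :: "tm \<Rightarrow> config \<Rightarrow> config" where
  "tm_step M (q, ts) =
     (if q = 1 \<or> q = 2 then (q, ts)
      else (case trans_fun M q (map (\<lambda>(t, h). t h) ts) of
              (q', as) \<Rightarrow> (q', map2 tape_act ts as)))"

definition tape_of :: "bool list \<Rightarrow> nat \<Rightarrow> nat" where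
  "tape_of x i = (if i < length x then (if x ! i then 2 else 1) else 0)"

definition init_config :: "tm \<Rightarrow> bool list \<Rightarrow> config" where
  "init_config M x = (0, (tape_of x, 0) # replicate (n_tapes M - 1) (\<lambda>_. 0, 0))"

definition tm_run :: "tm \<Rightarrow> bool list \<Rightarrow> nat \<Rightarrow> config" where
  "tm_run M x t = (tm_step M ^^ t) (init_config M x)"

definition decides_in_space :: "tm \<Rightarrow> bool list set \<Rightarrow> (nat \<Rightarrow> nat) \<Rightarrow> bool" where
  "decides_in_space M A s \<longleftrightarrow>
     (\<forall>x. (\<exists>t. fst (tm_run M x t) = (if x \<in> A then 1 else 2)) \<and>
          (\<forall>t. \<forall>(c, h) \<in> set (snd (tm_run M x t)). h < s (length x)))"

text \<open>As usual, PSPACE is defined with single-tape machines, while machines computing reductions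
  may have several tapes. Polynomial space and polynomial time do not depend on the number of
  tapes.\<close>

definition PSPACE :: "bool list set set" where
  "PSPACE = {A. \<exists>M (p :: nat poly). wf_tm M \<and> n_tapes M = 1 \<and> decides_in_space M A (poly p)}"

text \<open>The input is on the first tape, the output on the last one.\<close>

definition computes_in_time :: "tm \<Rightarrow> (bool list \<Rightarrow> bool list) \<Rightarrow> (nat \<Rightarrow> nat) \<Rightarrow> bool" where
  "computes_in_time M f T \<longleftrightarrow>
     (\<forall>x. \<exists>t \<le> T (length x).
        fst (tm_run M x t) = 1 \<and> fst (last (snd (tm_run M x t))) = tape_of (f x))"

definition polytime_computable :: "(bool list \<Rightarrow> bool list) \<Rightarrow> bool" where
  "polytime_computable f \<longleftrightarrow> (\<exists>M (p :: nat poly). wf_tm M \<and> computes_in_time M f (poly p))"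

definition polytime_reducible :: "bool list set \<Rightarrow> bool list set \<Rightarrow> bool" where
  "polytime_reducible A B \<longleftrightarrow> (\<exists>f. polytime_computable f \<and> (\<forall>x. x \<in> A \<longleftrightarrow> f x \<in> B))"

definition PSPACE_hard :: "bool list set \<Rightarrow> bool" where
  "PSPACE_hard B \<longleftrightarrow> (\<forall>A \<in> PSPACE. polytime_reducible A B)"

text \<open>Numbers are written in binary, least significant bit first. Every bit is preceded by
  \<open>True\<close>, and \<open>False\<close> ends the number, so that concatenated encodings can be separated.\<close>

fun enc_nat :: "nat \<Rightarrow> bool list" where
  "enc_nat n = (if n = 0 then [False] else True # odd n # enc_nat (n div 2))"

declare enc_nat.simps [simp del]

definition enc_int :: "int \<Rightarrow> bool list" where
  "enc_int z = (z < 0) # enc_nat (nat \<bar>z\<bar>)"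

definition enc_mat :: "int^2^2 \<Rightarrow> bool list" where
  "enc_mat A = enc_int (A $ 1 $ 1) @ enc_int (A $ 1 $ 2) @ enc_int (A $ 2 $ 1) @ enc_int (A $ 2 $ 2)"

text \<open>The finite set of generators is given by listing its elements.\<close>

definition enc_instance :: "(int^2^2) list \<Rightarrow> nat \<Rightarrow> bool list" where
  "enc_instance Gs k = enc_nat k @ concat (map enc_mat Gs)"

definition k_freeness_problem :: "bool list set" where
  "k_freeness_problem =
     {enc_instance Gs k | Gs k. set Gs \<subseteq> SL2Z \<and> k > 0 \<and> k_free (set Gs) k}"

text \<open>Every string encodes at most one instance.\<close>

lemma enc_nat_append_eq: "enc_nat m @ u = enc_nat n @ v \<longleftrightarrow> m = n \<and> u = v"
proof (induction m arbitrary: n rule: less_induct)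
  case (less m)
  show ?case
  proof (cases "m = 0 \<or> n = 0")
    case True
    then show ?thesis
      by (auto simp: enc_nat.simps [of m] enc_nat.simps [of n])
  next
    case False
    then have "enc_nat m @ u = enc_nat n @ v \<longleftrightarrow> odd m = odd n \<and> m div 2 = n div 2 \<and> u = v"
      using less.IH [of "m div 2" "n div 2"]
      by (auto simp: enc_nat.simps [of m] enc_nat.simps [of n])
    also have "\<dots> \<longleftrightarrow> m = n \<and> u = v"
      by (metis bit_eq_rec)
    finally show ?thesis .
  qed
qed

lemma enc_int_append_eq: "enc_int a @ u = enc_int b @ v \<longleftrightarrow> a = b \<and> u = v"
  by (auto simp: enc_int_def enc_nat_append_eq)

lemma enc_mat_append_eq: "enc_mat A @ u = enc_mat B @ v \<longleftrightarrow> A = B \<and> u = v"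
  by (auto simp: enc_mat_def enc_int_append_eq vec_eq_iff forall_2)

lemma enc_instance_eq_iff: "enc_instance Gs k = enc_instance Hs l \<longleftrightarrow> Gs = Hs \<and> k = l"
proof -
  have ne: "enc_mat A \<noteq> []" for A
    by (simp add: enc_mat_def enc_int_def)
  have "concat (map enc_mat Gs) = concat (map enc_mat Hs) \<longleftrightarrow> Gs = Hs"
  proof (induction Gs arbitrary: Hs)
    case Nil
    then show ?case by (cases Hs) (auto simp: ne)
  next
    case (Cons A Gs)
    then show ?case by (cases Hs) (auto simp: ne enc_mat_append_eq)
  qed
  then show ?thesis
    by (auto simp: enc_instance_def enc_nat_append_eq)
qed

end

theory Submission
  imports Defs
begin

text \<open>Let a machine decide a language within \<open>m\<close> cells on the given input, and consider \<open>m + 1\<close>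
  deterministic automata reading sequences of (head position, state, scanned symbol): one for the
  content of each cell and one for the head position and the state. A word is accepted by all of
  them iff it is a computation of the machine ending in the rejecting state.

  Every product of the generators \<open>R\<^sup>u L\<^sup>a R\<^sup>v\<close> with \<open>R = (1 1; 0 1)\<close>, \<open>L = (1 0; 1 1)\<close> and
  \<open>u, a, v \<ge> 1\<close> determines the letters \<open>a\<close> and the sums \<open>v + u'\<close> at the seams, by Euclid's
  algorithm. A transition \<open>i \<rightarrow> j\<close> on the letter \<open>a\<close> becomes the generator with \<open>u = N - p i\<close> and
  \<open>v = p j\<close>, so the seam shows \<open>N\<close> whatever the state is. Letter 1 starts and letter 2 ends a word,
  so the product spelling an accepted word has one factorization per accepting automaton. The
  numbers \<open>p j\<close> form a Sidon set, so at a seam other than \<open>N\<close> both states are determined and the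
  factorizations of different automata cannot continue together. Hence the semigroup is
  \<open>m\<close>-free iff no word is accepted by all automata, i.e. iff the machine does not reject.

  The list of generators is described by an expression language with bounded loops, which is
  compiled to counter machines and these to multi-tape machines, in polynomial time.\<close>

section \<open>Products of unipotent matrices and their factorizations\<close>

text \<open>A product reveals only its letters and seam sums, so a factorization may mix automata,
  jump to a wrong state at a seam, or spell several words in a row. Three devices control this. All
  start generators have left exponent 1, so a product can be cut before every letter 1 and the
  number of factorizations multiplies over the pieces; since primality rules out splits whose two
  counts both differ from 1, only single pieces matter. Determinism makes a factorization of a piece
  a function of its start generator, so a piece never has more factorizations than there are
  automata. Finally, a single automaton could jump unnoticed, but \<open>m + 1\<close>
  factorizations of a piece involve all \<open>m + 1\<close> automata at once, and two of them in
  different states bring the Sidon property into play. As \<open>k\<close> is part of the instance,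
  it can grow with the input and is set to the space bound \<open>m\<close>, one less than the
  number of automata. All numbers involved are polynomial in the input length, so unary counters
  suffice to compute them and binary occurs only in the output.\<close>

definition mat2 :: "int \<Rightarrow> int \<Rightarrow> int \<Rightarrow> int \<Rightarrow> int^2^2" where
  "mat2 a b c d = vector [vector [a, b], vector [c, d]]"

lemma mat2_nth [simp]:
  "mat2 a b c d $ 1 $ 1 = a" "mat2 a b c d $ 1 $ 2 = b"
  "mat2 a b c d $ 2 $ 1 = c" "mat2 a b c d $ 2 $ 2 = d"
  by (simp_all add: mat2_def)

lemma mat2_mult:
  "mat2 a b c d ** mat2 e f g h = mat2 (a*e + b*g) (a*f + b*h) (c*e + d*g) (c*f + d*h)"
  by (simp add: vec_eq_iff forall_2 matrix_matrix_mult_def sum_2)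

definition upper :: "nat \<Rightarrow> int^2^2" where "upper n = mat2 1 (int n) 0 1"
definition lower :: "nat \<Rightarrow> int^2^2" where "lower n = mat2 1 0 (int n) 1"

lemma upper_add: "upper (m + n) = upper m ** upper n"
  by (simp add: upper_def mat2_mult add.commute)

lemma upper_0: "upper 0 = mat 1"
  by (simp add: upper_def vec_eq_iff forall_2 mat_def)

type_synonym triple = "nat \<times> nat \<times> nat"

fun gen_mat :: "triple \<Rightarrow> int^2^2" where
  "gen_mat (u, a, v) = upper u ** lower a ** upper v"

lemma gen_mat_eq:
  "gen_mat (u, a, v) = mat2 (int (1 + u * a)) (int ((1 + u * a) * v + u)) (int a) (int (a * v + 1))"
  by (simp add: upper_def lower_def mat2_mult algebra_simps)

lemma det_gen_mat: "det (gen_mat t) = 1"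
  by (cases t) (simp add: gen_mat_eq det_2 algebra_simps del: gen_mat.simps)

lemma mat_prod_append: "mat_prod (As @ Bs) = mat_prod As ** mat_prod Bs"
  by (induction As) (simp_all add: mat_prod_def matrix_mul_assoc)

fun alt_prod :: "bool \<Rightarrow> nat list \<Rightarrow> int^2^2" where
  "alt_prod b [] = mat 1"
| "alt_prod b (e # es) = (if b then upper e else lower e) ** alt_prod (\<not> b) es"

text \<open>The exponents of the normal form of a product of generators, where \<open>c\<close> is the exponent
  carried over from the left.\<close>

fun exps :: "nat \<Rightarrow> triple list \<Rightarrow> nat list" where
  "exps c [] = [c]"
| "exps c ((u, a, v) # ts) = (c + u) # a # exps v ts"

text \<open>Neighbouring generators meet in \<open>upper v ** upper u\<close>, which fuses to
  \<open>upper (v + u)\<close>; multiplying out the fused exponents gives the same matrix.\<close>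

lemma alt_prod_exps: "alt_prod True (exps c ts) = upper c ** mat_prod (map gen_mat ts)"
proof (induction c ts rule: exps.induct)
  case (1 c)
  then show ?case by (simp add: mat_prod_def)
next
  case (2 c u a v ts)
  then show ?case by (simp add: upper_add mat_prod_def matrix_mul_assoc)
qed

text \<open>Up to order, the image of the vector (1, 1) under the alternating product. Starting from
  (1, 1) amounts to continued fractions whose last quotient is 1, which removes the usual ambiguity
  in their ending.\<close>

fun convergent_pair :: "nat list \<Rightarrow> nat \<times> nat" where
  "convergent_pair [] = (1, 1)"
| "convergent_pair (e # es) = (let (x, y) = convergent_pair es in (y + e * x, x))"

fun act :: "int^2^2 \<Rightarrow> int \<times> int \<Rightarrow> int \<times> int" where
  "act A (x, y) = (A $ 1 $ 1 * x + A $ 1 $ 2 * y, A $ 2 $ 1 * x + A $ 2 $ 2 * y)"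

lemma act_mult: "act (A ** B) z = act A (act B z)"
  by (cases z) (simp add: matrix_matrix_mult_def sum_2 algebra_simps)

lemma act_upper: "act (upper n) (x, y) = (x + int n * y, y)"
  by (simp add: upper_def)

lemma act_lower: "act (lower n) (x, y) = (x, y + int n * x)"
  by (simp add: lower_def)

lemma act_alt_prod:
  "act (alt_prod b es) (1, 1) =
     (let (x, y) = convergent_pair es in if b then (int x, int y) else (int y, int x))"
proof (induction es arbitrary: b)
  case Nil
  then show ?case by (simp add: mat_def)
next
  case (Cons e es)
  then show ?case
    by (auto simp: act_mult act_upper act_lower simp del: act.simps split: prod.splits)
qed

text \<open>Equal entries occur only for the empty list; this is how Euclid's algorithm knows where
  to stop.\<close>

lemma convergent_pair_bounds:
  assumes "0 \<notin> set es" "convergent_pair es = (x, y)"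
  shows "0 < y \<and> y \<le> x \<and> (es \<noteq> [] \<longrightarrow> y < x)"
  using assms
proof (induction es arbitrary: x y)
  case (Cons e es)
  obtain x' y' where xy: "convergent_pair es = (x', y')" by force
  have "0 < y'" "y' \<le> x'" "1 * x' \<le> e * x'"
    using Cons.IH[OF _ xy] Cons.prems(1) by auto
  moreover have "x = y' + e * x'" "y = x'" using Cons.prems(2) xy by auto
  ultimately show ?case by linarith
qed auto

text \<open>Euclid's algorithm recovers the exponents.\<close>

lemma convergent_pair_inj:
  assumes "0 \<notin> set es" "0 \<notin> set fs" "convergent_pair es = convergent_pair fs"
  shows "es = fs"
  using assms
proof (induction es arbitrary: fs)
  case Nil
  then show ?case
    using convergent_pair_bounds[of fs 1 1] by force
next
  case (Cons e es)
  obtain x y where xy: "convergent_pair es = (x, y)" by force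
  obtain f fs' where fs: "fs = f # fs'"
    using Cons.prems convergent_pair_bounds[of "e # es" 1 1] by (cases fs) force+
  obtain x' y' where xy': "convergent_pair fs' = (x', y')" by force
  have x: "x' = x" and eq: "y + e * x = y' + f * x"
    using Cons.prems(3) by (auto simp: fs xy xy')
  have b: "0 < y" "y \<le> x" "es \<noteq> [] \<Longrightarrow> y < x"
    using convergent_pair_bounds[OF _ xy] Cons.prems(1) by auto
  have b': "0 < y'" "y' \<le> x" "fs' \<noteq> [] \<Longrightarrow> y' < x"
    using convergent_pair_bounds[OF _ xy'] Cons.prems(2) fs x by auto
  \<comment> \<open>The remainder \<open>y\<close> ranges from 1 to \<open>x\<close>, not from 0 to
    \<open>x - 1\<close>. The value \<open>x\<close> occurs only for an empty tail, and reduction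
    modulo \<open>x\<close> sends it to 0, away from all smaller positive values.\<close>
  have "y = y'"
  proof -
    have "y mod x = y' mod x" using arg_cong[OF eq, of "\<lambda>z. z mod x"] by simp
    then show ?thesis using b b' by (cases "y = x"; cases "y' = x") auto
  qed
  then have "convergent_pair es = convergent_pair fs'" "e = f"
    using eq b x by (auto simp: xy xy')
  then show ?case using Cons.IH[of fs'] Cons.prems fs by auto
qed

definition positive :: "triple \<Rightarrow> bool" where
  "positive = (\<lambda>(u, a, v). 0 < u \<and> 0 < a \<and> 0 < v)"

lemma exps_pos:
  "\<forall>t\<in>set ts. positive t \<Longrightarrow> ts \<noteq> [] \<or> 0 < c \<Longrightarrow> 0 \<notin> set (exps c ts)"
  by (induction c ts rule: exps.induct) (auto simp: positive_def)

text \<open>Both matrices are applied to (1, 1), and the exponents are recovered from the resulting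
  pair. Conversely, the exponents determine the alternating product.\<close>

lemma mat_prod_gen_mat_eq_iff:
  assumes "\<forall>t\<in>set ts. positive t" "\<forall>t\<in>set ts'. positive t" "ts \<noteq> []" "ts' \<noteq> []"
  shows "mat_prod (map gen_mat ts) = mat_prod (map gen_mat ts') \<longleftrightarrow> exps 0 ts = exps 0 ts'"
proof
  assume "mat_prod (map gen_mat ts) = mat_prod (map gen_mat ts')"
  then have "alt_prod True (exps 0 ts) = alt_prod True (exps 0 ts')"
    by (simp add: alt_prod_exps)
  then have "convergent_pair (exps 0 ts) = convergent_pair (exps 0 ts')"
    using act_alt_prod[of True "exps 0 ts"] act_alt_prod[of True "exps 0 ts'"]
    by (simp split: prod.splits)
  then show "exps 0 ts = exps 0 ts'"
    using assms by (intro convergent_pair_inj exps_pos) auto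
next
  assume "exps 0 ts = exps 0 ts'"
  then show "mat_prod (map gen_mat ts) = mat_prod (map gen_mat ts')"
    using alt_prod_exps[of 0 ts] alt_prod_exps[of 0 ts'] by (simp add: upper_0)
qed

section \<open>Factorizations as lists of triples with equal exponents\<close>

lemma length_exps: "length (exps c ts) = Suc (2 * length ts)"
  by (induction c ts rule: exps.induct) auto

lemma exps_same_letters:
  "exps c ts = exps c' ts' \<Longrightarrow> map (fst \<circ> snd) ts = map (fst \<circ> snd) ts'"
proof (induction ts arbitrary: c c' ts')
  case Nil
  then show ?case by (cases ts') auto
next
  case (Cons t ts)
  from Cons.prems obtain t' ts'' where ts': "ts' = t' # ts''"
    by (cases t; cases ts') auto
  from Cons.prems have eq: "exps (snd (snd t)) ts = exps (snd (snd t')) ts''" "fst (snd t) = fst (snd t')"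
    by (cases t; cases t'; simp add: ts')+
  from Cons.IH[OF eq(1)] eq(2) show ?case by (simp add: ts')
qed

lemma exps_carry: "exps c ts = (c + hd (exps 0 ts)) # tl (exps 0 ts)"
  by (cases ts) auto

lemma exps_append:
  "exps c (ts @ us) = butlast (exps c ts) @ exps (last (exps c ts)) us"
proof (induction c ts rule: exps.induct)
  case (2 c u a v ts)
  moreover have "exps v ts \<noteq> []" by (cases ts) auto
  ultimately show ?case by simp
qed simp

lemma exps_append_cong:
  "exps 0 ts = exps 0 ts' \<Longrightarrow> exps 0 us = exps 0 us' \<Longrightarrow> exps 0 (ts @ us) = exps 0 (ts' @ us')"
  using exps_carry[of "last (exps 0 ts')" us] exps_carry[of "last (exps 0 ts')" us']
  by (simp add: exps_append)

text \<open>For nonempty \<open>ts\<close> over positive triples in \<open>T\<close> these represent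
  the factorizations of its product. Comparing exponents instead of matrices turns the counting into
  combinatorics of lists.\<close>

definition sim_facts :: "triple set \<Rightarrow> triple list \<Rightarrow> triple list set" where
  "sim_facts T ts = {ts'. set ts' \<subseteq> T \<and> exps 0 ts' = exps 0 ts}"

lemma sim_facts_length: "ts' \<in> sim_facts T ts \<Longrightarrow> length ts' = length ts"
  using length_exps[of 0 ts'] length_exps[of 0 ts] by (simp add: sim_facts_def)

lemma finite_sim_facts: "finite T \<Longrightarrow> finite (sim_facts T ts)"
  using sim_facts_length[of _ T ts]
  by (intro finite_subset[OF _ finite_lists_length_eq[of T "length ts"]])
     (auto simp: sim_facts_def)

text \<open>Equality of products is equality of exponents, and applied to lists of length one this
  makes \<open>gen_mat\<close> injective on \<open>T\<close>. The count is finite because the number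
  of exponents fixes the length of a factorization.\<close>

lemma dec_eq_card_sim_facts:
  assumes "finite T" "\<forall>t\<in>T. positive t" "set ts \<subseteq> T" "ts \<noteq> []"
  shows "dec (gen_mat ` T) (mat_prod (map gen_mat ts)) = enat (card (sim_facts T ts))"
proof -
  have inj: "inj_on gen_mat T"
  proof
    fix s t assume st: "s \<in> T" "t \<in> T" "gen_mat s = gen_mat t"
    then have "exps 0 [s] = exps 0 [t]"
      using mat_prod_gen_mat_eq_iff[of "[s]" "[t]"] assms(2) by (simp add: mat_prod_def)
    then show "s = t" by (cases s; cases t) simp
  qed
  have "factorizations (gen_mat ` T) (mat_prod (map gen_mat ts)) = map gen_mat ` sim_facts T ts"
    (is "?L = ?R")
  proof
    show "?L \<subseteq> ?R"
    proof
      fix As assume As: "As \<in> ?L"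
      then have "set As \<subseteq> gen_mat ` T" by (simp add: factorizations_def)
      then have "As \<in> lists (gen_mat ` T)" by auto
      then obtain ts' where ts': "ts' \<in> lists T" "As = map gen_mat ts'"
        by (auto simp: lists_image)
      have "exps 0 ts' = exps 0 ts"
        using As ts' assms
        by (intro mat_prod_gen_mat_eq_iff[THEN iffD1]) (auto simp: factorizations_def)
      then show "As \<in> ?R" using ts' by (auto simp: sim_facts_def)
    qed
    show "?R \<subseteq> ?L"
    proof
      fix As assume "As \<in> ?R"
      then obtain ts' where ts': "ts' \<in> sim_facts T ts" "As = map gen_mat ts'" by auto
      then have "ts' \<noteq> []" using sim_facts_length assms(4) by fastforce
      then show "As \<in> ?L"
        using ts' assms mat_prod_gen_mat_eq_iff[of ts' ts]
        by (auto simp: factorizations_def sim_facts_def)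
    qed
  qed
  moreover have "inj_on (map gen_mat) (sim_facts T ts)"
    by (rule inj_on_mapI[OF inj_on_subset[OF inj]]) (auto simp: sim_facts_def)
  ultimately show ?thesis
    using finite_sim_facts[OF assms(1), of ts] by (simp add: dec_def card_image)
qed

section \<open>Generators for a family of deterministic automata\<close>

inductive path :: "(nat \<times> nat \<times> nat) set \<Rightarrow> nat \<Rightarrow> nat list \<Rightarrow> nat \<Rightarrow> bool" for \<Delta> where
  path_Nil: "path \<Delta> i [] i"
| path_Cons: "(i, a, j) \<in> \<Delta> \<Longrightarrow> path \<Delta> j w f \<Longrightarrow> path \<Delta> i (a # w) f"

text \<open>The states of all automata share the numbers below \<open>n\<close>;
  \<open>component\<close> tells to which automaton a state belongs, and \<open>I\<close> holds the
  initial states of \<open>k + 1\<close> different automata. Letters 1 and 2 are reserved, hence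
  \<open>3 \<le> a\<close>. Positivity of \<open>k\<close> supplies a second automaton to compare
  with.\<close>

locale automata_code =
  fixes p :: "nat \<Rightarrow> nat" and N n k :: nat and \<Delta> :: "(nat \<times> nat \<times> nat) set"
    and I F :: "nat set" and component :: "nat \<Rightarrow> nat"
  assumes p_pos: "\<And>i. i < n \<Longrightarrow> 0 < p i" and p_less: "\<And>i. i < n \<Longrightarrow> p i < N"
    and sidon: "\<And>i j i' j'. \<lbrakk>i < n; j < n; i' < n; j' < n; p i + p j = p i' + p j'; i \<noteq> i'\<rbrakk>
       \<Longrightarrow> i = j' \<and> j = i'"
    and finite_Delta: "finite \<Delta>"
    and Delta_dom: "\<And>i a j. (i, a, j) \<in> \<Delta> \<Longrightarrow> i < n \<and> j < n \<and> 3 \<le> a"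
    and Delta_det: "\<And>i a j j'. (i, a, j) \<in> \<Delta> \<Longrightarrow> (i, a, j') \<in> \<Delta> \<Longrightarrow> j = j'"
    and Delta_comp: "\<And>i a j. (i, a, j) \<in> \<Delta> \<Longrightarrow> component j = component i"
    and I_sub: "I \<subseteq> {..<n}" and F_sub: "F \<subseteq> {..<n}"
    and comp_inj: "inj_on component I" and card_I: "card I = Suc k" and k_pos: "0 < k"
begin

definition T :: "triple set" where
  "T = (\<lambda>j. (1, 1, p j)) ` I \<union> (\<lambda>(i, a, j). (N - p i, a, p j)) ` \<Delta> \<union> (\<lambda>i. (N - p i, 2, 1)) ` F"

lemma finite_T: "finite T"
  using finite_Delta finite_subset[OF I_sub] finite_subset[OF F_sub] by (simp add: T_def)

lemma p_inj: "i < n \<Longrightarrow> j < n \<Longrightarrow> p i = p j \<Longrightarrow> i = j"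
  using sidon[of i i j i] by auto

lemma positive_T: "\<forall>t\<in>T. positive t"
  using p_pos p_less Delta_dom I_sub F_sub
  by (auto simp: T_def positive_def dest!: Delta_dom)

lemma T_cases:
  assumes "(u, a, v) \<in> T"
  obtains (start) j where "j \<in> I" "u = 1" "a = 1" "v = p j"
  | (step) i j where "(i, a, j) \<in> \<Delta>" "u = N - p i" "v = p j" "3 \<le> a" "i < n" "j < n"
  | (finish) i where "i \<in> F" "u = N - p i" "a = 2" "v = 1" "i < n"
proof -
  from assms consider "\<exists>j\<in>I. u = 1 \<and> a = 1 \<and> v = p j"
    | "\<exists>i j. (i, a, j) \<in> \<Delta> \<and> u = N - p i \<and> v = p j" | "\<exists>i\<in>F. u = N - p i \<and> a = 2 \<and> v = 1"
    unfolding T_def by auto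
  then show thesis
    by cases (use that F_sub Delta_dom in blast)+
qed

lemma exists_other_component: "\<exists>j'\<in>I. j' \<noteq> j"
proof (rule ccontr)
  assume "\<not> (\<exists>j'\<in>I. j' \<noteq> j)"
  then have "I \<subseteq> {j}" by auto
  then have "card I \<le> 1" using card_mono[of "{j}" I] by simp
  then show False using card_I k_pos by simp
qed

text \<open>The left exponent reveals the source state because \<open>p\<close> is injective, and
  the transitions are deterministic. Only the start generators, which agree in \<open>u\<close> and
  \<open>a\<close>, leave a choice.\<close>

lemma T_det:
  assumes "(u, a, v) \<in> T" "(u, a, v') \<in> T" "a \<noteq> 1"
  shows "v = v'"
  using assms(1)
proof (cases rule: T_cases)
  case s: (step i j)
  from assms(2) show ?thesis
  proof (cases rule: T_cases)
    case (step i' j')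
    then have "p i = p i'" using s p_less[of i] p_less[of i'] by linarith
    then show ?thesis using s step p_inj[of i i'] Delta_det by blast
  qed (use s in auto)
next
  case s: (finish i)
  from assms(2) show ?thesis by (cases rule: T_cases) (use s in auto)
qed (use assms in auto)

text \<open>Read from the left: the carry and the exponent give \<open>u\<close>, then
  \<open>T_det\<close> gives \<open>v\<close>, which is the next carry.\<close>

lemma exps_det:
  assumes "set ts \<subseteq> T" "set ts' \<subseteq> T" "exps c ts = exps c ts'" "\<forall>(u, a, v)\<in>set ts. a \<noteq> 1"
  shows "ts' = ts"
  using assms
proof (induction c ts arbitrary: ts' rule: exps.induct)
  case (1 c)
  then show ?case by (cases ts') auto
next
  case (2 c u a v ts)
  obtain v' ts'' where ts': "ts' = (u, a, v') # ts''" "exps v ts = exps v' ts''"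
    using "2.prems"(3) by (cases ts') auto
  moreover have "v' = v" using "2.prems"(1,2,4) ts' T_det[of u a v v'] by simp
  ultimately show ?case using "2.IH"[of ts''] "2.prems"(1,2,4) by simp
qed

lemma start_u: "(u, 1, v) \<in> T \<Longrightarrow> u = 1"
  by (erule T_cases) auto

text \<open>All start generators have the same left exponent, so in both lists the carry in front of
  the letter 1 is the same, and cutting there leaves equal exponents on either side.\<close>

lemma exps_cut:
  assumes "set ts \<subseteq> T" "set ts' \<subseteq> T" "(u, 1, v) \<in> T"
    and "exps c' ts' = exps c (ts @ (u, 1, v) # us)"
  shows "\<exists>ts1 ts2. ts' = ts1 @ ts2 \<and> exps c' ts1 = exps c ts \<and> exps 0 ts2 = exps 0 ((u, 1, v) # us)"
  using assms
proof (induction c ts arbitrary: c' ts' rule: exps.induct)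
  case (1 c)
  then obtain u' v' ts'' where ts': "ts' = (u', 1, v') # ts''"
    by (cases ts') auto
  then have "u' = 1" "u = 1" using 1 start_u by auto
  then show ?case using 1 ts' by (intro exI[of _ "[]"] exI[of _ ts']) auto
next
  case (2 c u1 a v1 ts)
  obtain u' v' ts'' where ts': "ts' = (u', a, v') # ts''"
    using "2.prems"(4) by (cases ts') auto
  then have "set ts \<subseteq> T" "set ts'' \<subseteq> T" "exps v' ts'' = exps v1 (ts @ (u, 1, v) # us)"
    using "2.prems"(1,2,4) by simp_all
  from "2.IH"[OF this(1,2) "2.prems"(3) this(3)] obtain ts1 ts2 where
    "ts'' = ts1 @ ts2" "exps v' ts1 = exps v1 ts" "exps 0 ts2 = exps 0 ((u, 1, v) # us)" by blast
  then show ?case using "2.prems"(4) ts' by (intro exI[of _ "(u', a, v') # ts1"] exI[of _ ts2]) auto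
qed

text \<open>The parts before and after a letter 1 can be factorized independently of each
  other.\<close>

lemma card_sim_facts_cut:
  assumes "set ts \<subseteq> T" "(u, 1, v) \<in> T"
  shows "card (sim_facts T (ts @ (u, 1, v) # us)) =
    card (sim_facts T ts) * card (sim_facts T ((u, 1, v) # us))"
proof -
  have "bij_betw (\<lambda>(x, y). x @ y) (sim_facts T ts \<times> sim_facts T ((u, 1, v) # us))
     (sim_facts T (ts @ (u, 1, v) # us))"
    unfolding bij_betw_def
  proof
    show "inj_on (\<lambda>(x, y). x @ y) (sim_facts T ts \<times> sim_facts T ((u, 1, v) # us))"
      by (auto simp: inj_on_def dest!: sim_facts_length)
    show "(\<lambda>(x, y). x @ y) ` (sim_facts T ts \<times> sim_facts T ((u, 1, v) # us)) =
        sim_facts T (ts @ (u, 1, v) # us)" (is "?L = ?R")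
    proof
      show "?L \<subseteq> ?R"
        unfolding sim_facts_def by (auto intro: exps_append_cong simp del: exps.simps)
      show "?R \<subseteq> ?L"
      proof
        fix ts' assume "ts' \<in> ?R"
        then have ts': "set ts' \<subseteq> T" "exps 0 ts' = exps 0 (ts @ (u, 1, v) # us)"
          by (auto simp: sim_facts_def)
        from exps_cut[OF assms(1) ts'(1) assms(2) ts'(2)] ts'(1)
        obtain ts1 ts2 where "ts' = ts1 @ ts2" "exps 0 ts1 = exps 0 ts"
          "exps 0 ts2 = exps 0 ((u, 1, v) # us)" by blast
        then show "ts' \<in> ?L"
          using ts'(1) by (intro image_eqI[of _ _ "(ts1, ts2)"]) (auto simp: sim_facts_def)
      qed
    qed
  qed
  then show ?thesis by (metis bij_betw_same_card card_cartesian_product)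
qed

lemma card_sim_facts_det:
  assumes "set ts \<subseteq> T" "\<forall>(u, a, v)\<in>set ts. a \<noteq> 1"
  shows "card (sim_facts T ts) = 1"
proof -
  have "sim_facts T ts = {ts}"
    using assms(1) exps_det[OF assms(1) _ _ assms(2), of _ 0] by (auto simp: sim_facts_def dest: sym)
  then show ?thesis by simp
qed

text \<open>Two components in different states force, by the Sidon property, every component to continue
  from the state it is in.\<close>

lemma common_exps_word:
  assumes "\<forall>(u, a, v)\<in>set ts. a \<noteq> 1"
    and "\<forall>j\<in>I. \<sigma> j < n \<and> component (\<sigma> j) = component j"
    and "\<forall>j\<in>I. \<exists>ts'. set ts' \<subseteq> T \<and> exps (p (\<sigma> j)) ts' = exps v ts"
  shows "\<exists>w. \<forall>j\<in>I. \<exists>f\<in>F. path \<Delta> (\<sigma> j) w f"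
  using assms
proof (induction ts arbitrary: v \<sigma>)
  case Nil
  obtain i j where ij: "i \<in> I" "j \<in> I" "i \<noteq> j"
    using exists_other_component by metis
  \<comment> \<open>With no generator left, the carry of every automaton is the last exponent. All
    automata would then be in one state, although their components differ.\<close>
  have "p (\<sigma> j) = v" if "j \<in> I" for j
  proof -
    from Nil.prems(3) that obtain ts' where "exps (p (\<sigma> j)) ts' = [v]" by auto
    then show ?thesis by (cases ts') auto
  qed
  then have "\<sigma> i = \<sigma> j" using ij Nil.prems(2) p_inj by metis
  then show ?case using ij Nil.prems(2) comp_inj by (metis inj_onD)
next
  case (Cons t ts)
  obtain u a v1 where t: "t = (u, a, v1)" by (cases t)
  have a: "a \<noteq> 1" using Cons.prems(1) t by auto
  have ex: "\<exists>u' v' ts'. (u', a, v') \<in> T \<and> p (\<sigma> j) + u' = v + u \<and> set ts' \<subseteq> T \<and> exps v' ts' = exps v1 ts"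
    if "j \<in> I" for j
  proof -
    from Cons.prems(3) that t obtain ts' where ts': "set ts' \<subseteq> T"
      "exps (p (\<sigma> j)) ts' = (v + u) # a # exps v1 ts" by auto
    then show ?thesis by (cases ts') (auto, blast)
  qed
  \<comment> \<open>The automata \<open>j\<close> and \<open>j'\<close> show the same seam sum, so
    \<open>p (\<sigma> j) + p i' = p (\<sigma> j') + p i\<close>. As \<open>\<sigma> j\<close> and
    \<open>\<sigma> j'\<close> differ, each of them must be the source of the generator used by its
    own automaton.\<close>
  have same: "i = \<sigma> j"
    if "j \<in> I" "i < n" "(N - p i, a, v') \<in> T" "p (\<sigma> j) + (N - p i) = v + u" for i j v'
  proof -
    obtain j' where j': "j' \<in> I" "j' \<noteq> j"
      using exists_other_component by blast
    have ne: "\<sigma> j' \<noteq> \<sigma> j"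
      using j' that(1) Cons.prems(2) comp_inj by (metis inj_onD)
    obtain u' v' where u': "(u', a, v') \<in> T" "p (\<sigma> j') + u' = v + u"
      using ex[OF j'(1)] by blast
    obtain i' where i': "i' < n" "u' = N - p i'"
      using u'(1) by (cases rule: T_cases) (use a in auto)
    have "p (\<sigma> j) + p i' = p (\<sigma> j') + p i"
      using u'(2) i' that p_less[of i] p_less[of i'] by linarith
    with sidon[of "\<sigma> j" i' "\<sigma> j'" i] show ?thesis
      using ne i' that j' Cons.prems(2) by metis
  qed
  show ?case
  proof (cases "a = 2")
    \<comment> \<open>Letter 2 closes the word; what follows in \<open>ts\<close> does not enter
      it.\<close>
    case True
    have "\<sigma> j \<in> F" if j: "j \<in> I" for j
    proof -
      obtain u' v' where u': "(u', a, v') \<in> T" "p (\<sigma> j) + u' = v + u"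
        using ex[OF j] by blast
      from u'(1) obtain i where "i \<in> F" "u' = N - p i" "i < n"
        by (cases rule: T_cases) (use True in auto)
      then show ?thesis using same[of j i v'] u' j by auto
    qed
    then show ?thesis by (intro exI[of _ "[]"]) (blast intro: path_Nil)
  next
    case False
    have "\<exists>s. (\<sigma> j, a, s) \<in> \<Delta> \<and> (\<exists>ts'. set ts' \<subseteq> T \<and> exps (p s) ts' = exps v1 ts)"
      if j: "j \<in> I" for j
    proof -
      obtain u' v' ts' where u': "(u', a, v') \<in> T" "p (\<sigma> j) + u' = v + u" "set ts' \<subseteq> T"
          "exps v' ts' = exps v1 ts"
        using ex[OF j] by blast
      from u'(1) obtain i s where "(i, a, s) \<in> \<Delta>" "u' = N - p i" "v' = p s" "i < n"
        by (cases rule: T_cases) (use a False in auto)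
      moreover from this have "i = \<sigma> j" using same[of j i v'] u' j by auto
      ultimately show ?thesis using u' by auto
    qed
    then obtain \<tau> where \<tau>: "\<And>j. j \<in> I \<Longrightarrow> (\<sigma> j, a, \<tau> j) \<in> \<Delta> \<and>
        (\<exists>ts'. set ts' \<subseteq> T \<and> exps (p (\<tau> j)) ts' = exps v1 ts)"
      by metis
    have "\<tau> j < n \<and> component (\<tau> j) = component j" if "j \<in> I" for j
      using \<tau>[OF that] Cons.prems(2) that Delta_dom Delta_comp by metis
    then have "\<exists>w. \<forall>j\<in>I. \<exists>f\<in>F. path \<Delta> (\<tau> j) w f"
      using Cons.prems(1) \<tau> by (intro Cons.IH[of _ v1]) simp_all
    then obtain w where "\<forall>j\<in>I. \<exists>f\<in>F. path \<Delta> (\<tau> j) w f" by blast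
    then show ?thesis using \<tau> by (intro exI[of _ "a # w"]) (blast intro: path_Cons)
  qed
qed

text \<open>By determinism a factorization is fixed by its start generator, which leaves at most
  \<open>k + 1\<close>. If all of them occurred, \<open>common_exps_word\<close> would yield a word
  accepted by every automaton.\<close>

lemma card_sim_facts_segment:
  assumes "\<nexists>w. \<forall>j\<in>I. \<exists>f\<in>F. path \<Delta> j w f"
    and "set ((u, 1, v) # ts) \<subseteq> T" "\<forall>(u, a, v)\<in>set ts. a \<noteq> 1"
  shows "card (sim_facts T ((u, 1, v) # ts)) \<le> k"
proof -
  let ?D = "sim_facts T ((u, 1, v) # ts)" and ?f = "\<lambda>ts. snd (snd (hd ts))"
  have D: "\<exists>j ts''. j \<in> I \<and> ts' = (1, 1, p j) # ts'' \<and> set ts'' \<subseteq> T \<and> exps (p j) ts'' = exps v ts"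
    if D: "ts' \<in> ?D" for ts'
  proof -
    from D obtain u' v' ts'' where ts': "ts' = (u', 1, v') # ts''"
      by (cases ts') (auto simp: sim_facts_def)
    have "(u', 1, v') \<in> T" using D ts' by (auto simp: sim_facts_def)
    then obtain j where "j \<in> I" "u' = 1" "v' = p j" by (cases rule: T_cases) auto
    then show ?thesis using D ts' by (auto simp: sim_facts_def)
  qed
  have inj: "inj_on ?f ?D"
  proof
    fix x y assume xy: "x \<in> ?D" "y \<in> ?D" "?f x = ?f y"
    obtain j x' where x: "x = (1, 1, p j) # x'" "set x' \<subseteq> T" "exps (p j) x' = exps v ts"
      using D[OF xy(1)] by blast
    obtain y' where y: "y = (1, 1, p j) # y'" "set y' \<subseteq> T" "exps (p j) y' = exps v ts"
      using D[OF xy(2)] xy(3) x by auto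
    have letters: "(\<forall>(u, a, v)\<in>set zs. a \<noteq> 1) \<longleftrightarrow> 1 \<notin> set (map (fst \<circ> snd) zs)" for zs :: "triple list"
      by force
    have "\<forall>(u, a, v)\<in>set x'. a \<noteq> 1" using assms(3) letters[of ts] letters[of x'] exps_same_letters[OF x(3)] by metis
    then show "x = y" using exps_det[of x' y' "p j"] x y by auto
  qed
  have sub: "?f ` ?D \<subseteq> p ` I" using D by fastforce
  have inj_p: "inj_on p I" using p_inj I_sub by (auto simp: inj_on_def)
  have fin: "finite (p ` I)" using finite_subset[OF I_sub] by auto
  have "card ?D = card (?f ` ?D)" using inj by (simp add: card_image)
  moreover have "card (?f ` ?D) \<le> Suc k" using card_mono[OF fin sub] card_image[OF inj_p] card_I by simp
  moreover have "card (?f ` ?D) \<noteq> Suc k"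
  proof
    assume "card (?f ` ?D) = Suc k"
    then have eq: "?f ` ?D = p ` I"
      using card_subset_eq[OF fin sub] card_image[OF inj_p] card_I by simp
    have "\<forall>j\<in>I. \<exists>ts'. set ts' \<subseteq> T \<and> exps (p j) ts' = exps v ts"
    proof
      fix j assume "j \<in> I"
      then obtain ts' where ts': "ts' \<in> ?D" "p j = ?f ts'" using eq by blast
      then obtain j' ts'' where "ts' = (1, 1, p j') # ts''" "set ts'' \<subseteq> T" "exps (p j') ts'' = exps v ts"
        using D by blast
      then show "\<exists>ts'. set ts' \<subseteq> T \<and> exps (p j) ts' = exps v ts" using ts' by auto
    qed
    moreover have "\<forall>j\<in>I. j < n \<and> component j = component j" using I_sub by auto
    ultimately show False
      using common_exps_word[OF assms(3), of "\<lambda>j. j" v] assms(1) by blast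
  qed
  ultimately show ?thesis by linarith
qed

text \<open>Split off the last piece beginning with letter 1, which has at most \<open>k\<close>
  factorizations. A count above \<open>k\<close> then shows ambiguity on both sides of the cut or,
  if the last piece has one factorization only, in the part before it.\<close>

lemma card_sim_facts_le_or_split:
  assumes no_word: "\<nexists>w. \<forall>j\<in>I. \<exists>f\<in>F. path \<Delta> j w f" and "set ts \<subseteq> T" "ts \<noteq> []"
  shows "card (sim_facts T ts) \<le> k \<or>
    (\<exists>ts1 ts2. ts = ts1 @ ts2 \<and> ts1 \<noteq> [] \<and> ts2 \<noteq> [] \<and>
       card (sim_facts T ts) = card (sim_facts T ts1) * card (sim_facts T ts2) \<and>
       card (sim_facts T ts1) \<noteq> 1 \<and> card (sim_facts T ts2) \<noteq> 1)"
  using assms(2,3)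
proof (induction "length ts" arbitrary: ts rule: less_induct)
  case less
  show ?case
  proof (cases "\<exists>t\<in>set ts. fst (snd t) = 1")
    case False
    then have "card (sim_facts T ts) = 1"
      using less by (intro card_sim_facts_det) auto
    then show ?thesis using k_pos by simp
  next
    case True
    then obtain ys t zs where ts: "ts = ys @ t # zs" "fst (snd t) = 1" "\<forall>t\<in>set zs. fst (snd t) \<noteq> 1"
      using split_list_last_prop[of ts "\<lambda>t. fst (snd t) = 1"] by blast
    then obtain u v where t: "t = (u, 1, v)" by (cases t) auto
    have T: "set ys \<subseteq> T" "set zs \<subseteq> T" "(u, 1, v) \<in> T" using less.prems ts t by auto
    let ?s = "(u, 1, v) # zs"
    have seg: "card (sim_facts T ?s) \<le> k"
      using T ts by (intro card_sim_facts_segment[OF no_word]) auto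
    have prod: "card (sim_facts T (xs @ ?s)) = card (sim_facts T xs) * card (sim_facts T ?s)"
      if "set xs \<subseteq> T" for xs
      using card_sim_facts_cut[OF that T(3)] .
    show ?thesis
    proof (cases "ys = []")
      case True
      then show ?thesis using seg ts t by simp
    next
      case False
      consider "card (sim_facts T ys) = 1" | "card (sim_facts T ?s) = 1"
        | "card (sim_facts T ys) \<noteq> 1" "card (sim_facts T ?s) \<noteq> 1" by blast
      then show ?thesis
      proof cases
        case 1
        then show ?thesis using seg prod[OF T(1)] ts t by simp
      next
        case 2
        have "length ys < length ts" using ts by simp
        from less.hyps[OF this T(1) False] show ?thesis
        proof
          assume "card (sim_facts T ys) \<le> k"
          then show ?thesis using 2 prod[OF T(1)] ts t by simp
        next
          assume "\<exists>ts1 ts2. ys = ts1 @ ts2 \<and> ts1 \<noteq> [] \<and> ts2 \<noteq> [] \<and>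
            card (sim_facts T ys) = card (sim_facts T ts1) * card (sim_facts T ts2) \<and>
            card (sim_facts T ts1) \<noteq> 1 \<and> card (sim_facts T ts2) \<noteq> 1"
          then obtain ts1 ts2 where ys: "ys = ts1 @ ts2" "ts1 \<noteq> []"
            "card (sim_facts T ys) = card (sim_facts T ts1) * card (sim_facts T ts2)"
            "card (sim_facts T ts1) \<noteq> 1" "card (sim_facts T ts2) \<noteq> 1" by blast
          \<comment> \<open>Appending the unambiguous piece to \<open>ts2\<close> does not change
            the count of \<open>ts2\<close>, so the split of \<open>ys\<close> extends to one of
            \<open>ts\<close>.\<close>
          have "set ts2 \<subseteq> T" using ys T by auto
          from prod[OF this] prod[OF T(1)] 2 ys show ?thesis
            by (intro disjI2 exI[of _ ts1] exI[of _ "ts2 @ ?s"]) (simp add: ts t)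
        qed
      next
        case 3
        then show ?thesis using prod[OF T(1)] False
          by (intro disjI2 exI[of _ ys] exI[of _ ?s]) (simp add: ts t)
      qed
    qed
  qed
qed

lemma semigroup_gen_image: "semigroup_gen (gen_mat ` T) = {mat_prod (map gen_mat ts) | ts. ts \<noteq> [] \<and> set ts \<subseteq> T}"
proof -
  have "(\<exists>As. M = mat_prod As \<and> As \<noteq> [] \<and> set As \<subseteq> gen_mat ` T) \<longleftrightarrow>
      (\<exists>ts. M = mat_prod (map gen_mat ts) \<and> ts \<noteq> [] \<and> set ts \<subseteq> T)" for M
  proof
    assume "\<exists>As. M = mat_prod As \<and> As \<noteq> [] \<and> set As \<subseteq> gen_mat ` T"
    then obtain As where As: "M = mat_prod As" "As \<noteq> []" "As \<in> lists (gen_mat ` T)" by auto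
    then obtain ts where "As = map gen_mat ts" "ts \<in> lists T" by (auto simp: lists_image)
    then show "\<exists>ts. M = mat_prod (map gen_mat ts) \<and> ts \<noteq> [] \<and> set ts \<subseteq> T" using As by auto
  qed (metis image_mono list.set_map map_is_Nil_conv)
  then show ?thesis by (simp add: semigroup_gen_def)
qed

lemma dec_T:
  "set ts \<subseteq> T \<Longrightarrow> ts \<noteq> [] \<Longrightarrow>
    dec (gen_mat ` T) (mat_prod (map gen_mat ts)) = enat (card (sim_facts T ts))"
  using dec_eq_card_sim_facts[OF finite_T positive_T] by blast

text \<open>Along a path every seam is \<open>p i + (N - p i) = N\<close>, so the exponents depend
  on the word only and are the same for all automata.\<close>

lemma path_exps:
  assumes "path \<Delta> i w f" "f \<in> F"
  shows "\<exists>ts. set ts \<subseteq> T \<and> exps (p i) ts = concat (map (\<lambda>a. [N, a]) w) @ [N, 2, 1]"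
  using assms
proof (induction rule: path.induct)
  case (path_Nil f)
  then have "(N - p f, 2, 1) \<in> T" "p f < N" using F_sub p_less by (auto simp: T_def)
  then show ?case by (intro exI[of _ "[(N - p f, 2, 1)]"]) auto
next
  case (path_Cons i a j w f)
  then obtain ts where ts: "set ts \<subseteq> T" "exps (p j) ts = concat (map (\<lambda>a. [N, a]) w) @ [N, 2, 1]"
    by blast
  have "(N - p i, a, p j) \<in> T"
    using path_Cons.hyps(1) unfolding T_def by (intro UnI1 UnI2 image_eqI[of _ _ "(i, a, j)"]) auto
  moreover have "p i < N"
    using p_less Delta_dom[OF path_Cons.hyps(1)] by blast
  ultimately show ?case using ts by (intro exI[of _ "(N - p i, a, p j) # ts"]) auto
qed

lemma exps_letters:
  assumes "exps c ts = concat (map (\<lambda>a. [N, a]) w) @ [N, 2, 1]" "(u, a, v) \<in> set ts"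
  shows "a \<in> insert 2 (set w)"
  using assms
proof (induction w arbitrary: c ts)
  case Nil
  then obtain u' a' v' ts' where "ts = (u', a', v') # ts'" by (cases ts) auto
  then show ?case using Nil by (cases ts') auto
next
  case (Cons b w)
  then obtain u' a' v' ts' where ts: "ts = (u', a', v') # ts'" by (cases ts) auto
  then have "exps v' ts' = concat (map (\<lambda>a. [N, a]) w) @ [N, 2, 1]" "a' = b" using Cons.prems by auto
  then show ?case using Cons ts by auto
qed

lemma path_letters: "path \<Delta> i w f \<Longrightarrow> a \<in> set w \<Longrightarrow> 3 \<le> a"
  by (induction rule: path.induct) (auto dest: Delta_dom)

text \<open>Without a common word, a product with more than \<open>k\<close> factorizations has a
  split that contradicts primality. A common word gives a product with \<open>k + 1\<close>
  factorizations, one for each automaton, and it is prime because none of its proper right factors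
  contains letter 1.\<close>

theorem k_free_iff_no_common_word:
  "k_free (gen_mat ` T) k \<longleftrightarrow> (\<nexists>w. \<forall>j\<in>I. \<exists>f\<in>F. path \<Delta> j w f)"
proof
  assume no_word: "\<nexists>w. \<forall>j\<in>I. \<exists>f\<in>F. path \<Delta> j w f"
  show "k_free (gen_mat ` T) k"
    unfolding k_free_def
  proof (intro allI impI)
    fix M assume M: "prime_matrix (gen_mat ` T) M"
    then obtain ts where ts: "M = mat_prod (map gen_mat ts)" "ts \<noteq> []" "set ts \<subseteq> T"
      by (auto simp: prime_matrix_def semigroup_gen_image)
    from card_sim_facts_le_or_split[OF no_word ts(3,2)] show "dec (gen_mat ` T) M \<le> enat k"
    proof
      assume "card (sim_facts T ts) \<le> k"
      then show ?thesis using ts dec_T by simp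
    next
      assume "\<exists>ts1 ts2. ts = ts1 @ ts2 \<and> ts1 \<noteq> [] \<and> ts2 \<noteq> [] \<and>
         card (sim_facts T ts) = card (sim_facts T ts1) * card (sim_facts T ts2) \<and>
         card (sim_facts T ts1) \<noteq> 1 \<and> card (sim_facts T ts2) \<noteq> 1"
      then obtain ts1 ts2 where s: "ts = ts1 @ ts2" "ts1 \<noteq> []" "ts2 \<noteq> []"
         "card (sim_facts T ts) = card (sim_facts T ts1) * card (sim_facts T ts2)"
         "card (sim_facts T ts1) \<noteq> 1" "card (sim_facts T ts2) \<noteq> 1" by blast
      let ?M1 = "mat_prod (map gen_mat ts1)" and ?M2 = "mat_prod (map gen_mat ts2)"
      have "?M1 \<in> semigroup_gen (gen_mat ` T)" "?M2 \<in> semigroup_gen (gen_mat ` T)"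
        using s ts by (auto simp: semigroup_gen_image)
      moreover have "M = ?M1 ** ?M2" using ts s by (simp add: mat_prod_append)
      moreover have "dec (gen_mat ` T) M = dec (gen_mat ` T) ?M1 * dec (gen_mat ` T) ?M2"
        "dec (gen_mat ` T) ?M1 \<noteq> 1" "dec (gen_mat ` T) ?M2 \<noteq> 1"
        using ts s dec_T[of ts] dec_T[of ts1] dec_T[of ts2] by (auto simp: one_enat_def)
      ultimately show ?thesis using M unfolding prime_matrix_def by blast
    qed
  qed
next
  assume free: "k_free (gen_mat ` T) k"
  show "\<nexists>w. \<forall>j\<in>I. \<exists>f\<in>F. path \<Delta> j w f"
  proof
    assume "\<exists>w. \<forall>j\<in>I. \<exists>f\<in>F. path \<Delta> j w f"
    then obtain w where w: "\<forall>j\<in>I. \<exists>f\<in>F. path \<Delta> j w f" by blast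
    let ?E = "concat (map (\<lambda>a. [N, a]) w) @ [N, 2, 1]"
    have "\<forall>j\<in>I. \<exists>ts. set ts \<subseteq> T \<and> exps (p j) ts = ?E" using w path_exps by blast
    then obtain \<tau> where \<tau>: "\<And>j. j \<in> I \<Longrightarrow> set (\<tau> j) \<subseteq> T \<and> exps (p j) (\<tau> j) = ?E" by metis
    define full where "full j = (1, 1, p j) # \<tau> j" for j
    have full: "set (full j) \<subseteq> T" "exps 0 (full j) = 1 # 1 # ?E" if "j \<in> I" for j
      using \<tau> that by (auto simp: full_def T_def)
    obtain j0 where j0: "j0 \<in> I" using card_I by fastforce
    let ?M = "mat_prod (map gen_mat (full j0))"
    have "full ` I \<subseteq> sim_facts T (full j0)" using full j0 by (auto simp: sim_facts_def)
    moreover have "inj_on full I" using p_inj I_sub by (auto simp: inj_on_def full_def)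
    ultimately have "Suc k \<le> card (sim_facts T (full j0))"
      using card_mono[OF finite_sim_facts[OF finite_T]] card_image card_I by metis
    then have "\<not> dec (gen_mat ` T) ?M \<le> enat k"
      using dec_T[OF full(1)[OF j0]] by (simp add: full_def)
    moreover have "prime_matrix (gen_mat ` T) ?M"
      unfolding prime_matrix_def
    proof
      show "?M \<in> semigroup_gen (gen_mat ` T)"
        unfolding semigroup_gen_image using full(1)[OF j0]
        by (intro CollectI exI[of _ "full j0"] conjI refl) (simp_all add: full_def)
      \<comment> \<open>The only letter 1 is the very first one and falls into the left factor; the
        right factor is then factorized deterministically.\<close>
      have "dec (gen_mat ` T) M2 = 1"
        if M: "M1 \<in> semigroup_gen (gen_mat ` T)" "M2 \<in> semigroup_gen (gen_mat ` T)" "?M = M1 ** M2" for M1 M2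
      proof -
        obtain ts1 ts2 where ts1: "M1 = mat_prod (map gen_mat ts1)" "ts1 \<noteq> []" "set ts1 \<subseteq> T"
          and ts2: "M2 = mat_prod (map gen_mat ts2)" "ts2 \<noteq> []" "set ts2 \<subseteq> T"
          using M by (auto simp: semigroup_gen_image)
        have "mat_prod (map gen_mat (ts1 @ ts2)) = ?M" using M ts1 ts2 by (simp add: mat_prod_append)
        then have "exps 0 (ts1 @ ts2) = 1 # 1 # ?E"
          using full[OF j0] ts1 ts2 positive_T mat_prod_gen_mat_eq_iff[of "ts1 @ ts2" "full j0"]
          by (auto simp: full_def)
        then obtain v ts1' where "exps v (ts1' @ ts2) = ?E"
          using ts1(2) by (cases ts1) auto
        then have "\<forall>(u, a, v)\<in>set ts2. a \<in> insert 2 (set w)" using exps_letters by fastforce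
        then have "\<forall>(u, a, v)\<in>set ts2. a \<noteq> 1" using w j0 path_letters by fastforce
        then show ?thesis using card_sim_facts_det[OF ts2(3)] dec_T[OF ts2(3,2)] ts2(1)
          by (simp add: one_enat_def)
      qed
      then show "\<not> (\<exists>M1\<in>semigroup_gen (gen_mat ` T). \<exists>M2\<in>semigroup_gen (gen_mat ` T).
        ?M = M1 ** M2 \<and> dec (gen_mat ` T) ?M = dec (gen_mat ` T) M1 * dec (gen_mat ` T) M2 \<and>
        dec (gen_mat ` T) M1 \<noteq> 1 \<and> dec (gen_mat ` T) M2 \<noteq> 1)" by blast
    qed
    ultimately show False using free by (auto simp: k_free_def)
  qed
qed

end

section \<open>Space-bounded machines as families of automata\<close>

lemma mult_add_eq_iff:
  fixes b b' c i i' :: nat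
  assumes "b < c" "b' < c"
  shows "i * c + b = i' * c + b' \<longleftrightarrow> i = i' \<and> b = b'"
proof
  assume eq: "i * c + b = i' * c + b'"
  have "(i * c + b) div c = i" "(i' * c + b') div c = i'" using assms by simp_all
  then show "i = i' \<and> b = b'" using eq by auto
qed simp

lemma mult_add_less:
  fixes b c i m :: nat
  assumes "b < c" "i < m"
  shows "i * c + b < m * c"
proof -
  have "Suc i * c \<le> m * c" using assms by (intro mult_right_mono) auto
  then show ?thesis using assms by simp
qed

definition tm_next :: "tm \<Rightarrow> nat \<Rightarrow> nat \<Rightarrow> nat \<times> nat \<times> dir" where
  "tm_next M q a = (case trans_fun M q [a] of (q', as) \<Rightarrow> (q', hd as))"

locale space_bounded_tm =
  fixes M :: tm and x :: "bool list" and m :: nat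
  assumes wf: "wf_tm M" and one_tape: "n_tapes M = 1"
    and space: "\<And>t c h. (c, h) \<in> set (snd (tm_run M x t)) \<Longrightarrow> h < m"
begin

abbreviation "Q \<equiv> n_states M"
abbreviation "Y \<equiv> n_syms M"

text \<open>Mixed-radix codes: the cell states fill the numbers below \<open>m * Y\<close>, the
  control states the \<open>m * Q\<close> numbers after them. Letters start at 3 because 1 and 2 are
  reserved.\<close>

definition cell :: "nat \<Rightarrow> nat \<Rightarrow> nat" where "cell i b = i * Y + b"
definition control :: "nat \<Rightarrow> nat \<Rightarrow> nat" where "control h q = m * Y + (h * Q + q)"
definition letter :: "nat \<Rightarrow> nat \<Rightarrow> nat \<Rightarrow> nat" where "letter h q a = 3 + ((h * Q + q) * Y + a)"

definition state :: "nat \<Rightarrow> nat" where "state t = fst (tm_run M x t)"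
definition content :: "nat \<Rightarrow> nat \<Rightarrow> nat" where "content t = fst (hd (snd (tm_run M x t)))"
definition head :: "nat \<Rightarrow> nat" where "head t = snd (hd (snd (tm_run M x t)))"

lemma Q_ge: "3 \<le> Q" and Y_ge: "3 \<le> Y"
  using wf by (auto simp: wf_tm_def)

lemma tm_next_range:
  assumes "q < Q" "a < Y" "tm_next M q a = (q', a', d)"
  shows "q' < Q" "a' < Y" "trans_fun M q [a] = (q', [(a', d)])"
proof -
  obtain q1 as where tr: "trans_fun M q [a] = (q1, as)" by force
  then have *: "q1 < Q \<and> length as = 1 \<and> fst ` set as \<subseteq> {..<Y}"
    using wf one_tape assms unfolding wf_tm_def by (metis bot.extremum empty_set insert_subset
        length_Cons list.set(2) list.size(3) lessThan_iff One_nat_def)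
  then obtain z where "as = [z]" by (cases as) auto
  then show "q' < Q" "a' < Y" "trans_fun M q [a] = (q', [(a', d)])"
    using * tr assms(3) by (auto simp: tm_next_def)
qed

lemma run_eq: "tm_run M x t = (state t, [(content t, head t)])"
  and state_less: "state t < Q" and content_less: "content t i < Y"
proof -
  have "\<exists>q c h. tm_run M x t = (q, [(c, h)]) \<and> q < Q \<and> (\<forall>i. c i < Y)"
  proof (induction t)
    case 0
    then show ?case using Q_ge Y_ge one_tape by (auto simp: tm_run_def init_config_def tape_of_def)
  next
    case (Suc t)
    then obtain q c h where IH: "tm_run M x t = (q, [(c, h)])" "q < Q" "\<forall>i. c i < Y" by blast
    obtain q' a' d where nx: "tm_next M q (c h) = (q', a', d)" by (metis prod_cases3)
    have "tm_run M x (Suc t) = tm_step M (q, [(c, h)])"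
      using IH by (simp add: tm_run_def)
    then show ?case
      using IH tm_next_range[OF IH(2) _ nx] by auto
  qed
  then show "tm_run M x t = (state t, [(content t, head t)])" "state t < Q" "content t i < Y"
    by (auto simp: state_def content_def head_def)
qed

lemma head_less: "head t < m"
  using space[of "content t" "head t" t] by (simp add: run_eq)

lemma m_pos: "0 < m"
  using head_less[of 0] by simp

lemma run_0: "state 0 = 0" "content 0 = tape_of x" "head 0 = 0"
  using one_tape by (simp_all add: state_def content_def head_def tm_run_def init_config_def)

lemma run_Suc_halted: "state t = 1 \<or> state t = 2 \<Longrightarrow> state (Suc t) = state t"
  using run_eq[of t] by (auto simp: state_def tm_run_def)

lemma run_Suc:
  assumes "state t \<noteq> 1" "state t \<noteq> 2" "tm_next M (state t) (content t (head t)) = (q', a', d)"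
  shows "state (Suc t) = q'" "content (Suc t) = (content t)(head t := a')" "head (Suc t) = move_head d (head t)"
proof -
  have "tm_run M x (Suc t) = tm_step M (state t, [(content t, head t)])"
    using run_eq[of t] by (simp add: tm_run_def)
  then have "tm_run M x (Suc t) = (q', [((content t)(head t := a'), move_head d (head t))])"
    using tm_next_range[OF state_less content_less assms(3)] assms(1,2) by simp
  then show "state (Suc t) = q'" "content (Suc t) = (content t)(head t := a')" "head (Suc t) = move_head d (head t)"
    by (simp_all add: state_def content_def head_def)
qed

lemma state_absorbing: "state t = 1 \<or> state t = 2 \<Longrightarrow> state (t + d) = state t"
  by (induction d) (use run_Suc_halted in auto)

text \<open>A letter claims a head position, a state and a scanned symbol. Cell \<open>h\<close>
  checks the symbol and performs the write, the other cells ignore the letter, and the control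
  automaton checks position and state. Nothing leaves a halting state. The bound on the new head
  position keeps the target among the \<open>n\<close> states; in the actual run it always
  holds.\<close>

inductive_set \<Delta> :: "(nat \<times> nat \<times> nat) set" where
  stays: "\<lbrakk>i < m; h < m; i \<noteq> h; b < Y; q < Q; q \<noteq> 1; q \<noteq> 2; a < Y\<rbrakk>
    \<Longrightarrow> (cell i b, letter h q a, cell i b) \<in> \<Delta>"
| writes: "\<lbrakk>h < m; q < Q; q \<noteq> 1; q \<noteq> 2; a < Y; tm_next M q a = (q', a', d)\<rbrakk>
    \<Longrightarrow> (cell h a, letter h q a, cell h a') \<in> \<Delta>"
| moves: "\<lbrakk>h < m; q < Q; q \<noteq> 1; q \<noteq> 2; a < Y; tm_next M q a = (q', a', d); move_head d h < m\<rbrakk>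
    \<Longrightarrow> (control h q, letter h q a, control (move_head d h) q') \<in> \<Delta>"

definition I where "I = insert (control 0 0) ((\<lambda>i. cell i (tape_of x i)) ` {..<m})"
text \<open>The cells accept in any state; the test for rejection is left to the control
  automaton.\<close>

definition F where "F = (\<lambda>(i, b). cell i b) ` ({..<m} \<times> {..<Y}) \<union> (\<lambda>h. control h 2) ` {..<m}"
definition n where "n = m * (Y + Q)"
definition B where "B = 2 * n * n + 1"
text \<open>The summand 1 keeps \<open>p 0\<close> positive, since exponents must not vanish. For
  the same reason \<open>N\<close> is chosen as \<open>p n + 1\<close>, above all \<open>p i\<close>
  with \<open>i < n\<close>.\<close>

definition p where "p j = 1 + j * B + j * j"
definition N where "N = 2 + n * B + n * n"
definition component where "component j = (if j < m * Y then j div Y else m)"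

lemma cell_less: "i < m \<Longrightarrow> b < Y \<Longrightarrow> cell i b < m * Y"
  by (simp add: cell_def mult_add_less)

lemma cell_less_n: "i < m \<Longrightarrow> b < Y \<Longrightarrow> cell i b < n"
  using cell_less[of i b] by (simp add: n_def algebra_simps)

lemma control_less_n: "h < m \<Longrightarrow> q < Q \<Longrightarrow> control h q < n"
  by (simp add: control_def n_def mult_add_less distrib_left)

lemma cell_neq_control: "i < m \<Longrightarrow> b < Y \<Longrightarrow> cell i b \<noteq> control h q" "i < m \<Longrightarrow> b < Y \<Longrightarrow> control h q \<noteq> cell i b"
  using cell_less[of i b] by (auto simp: control_def)

lemma cell_eq_iff: "b < Y \<Longrightarrow> b' < Y \<Longrightarrow> cell i b = cell i' b' \<longleftrightarrow> i = i' \<and> b = b'"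
  by (simp add: cell_def mult_add_eq_iff)

lemma control_eq_iff: "q < Q \<Longrightarrow> q' < Q \<Longrightarrow> control h q = control h' q' \<longleftrightarrow> h = h' \<and> q = q'"
  by (simp add: control_def mult_add_eq_iff)

lemma letter_eq_iff:
  "q < Q \<Longrightarrow> q' < Q \<Longrightarrow> a < Y \<Longrightarrow> a' < Y \<Longrightarrow>
    letter h q a = letter h' q' a' \<longleftrightarrow> h = h' \<and> q = q' \<and> a = a'"
  by (simp add: letter_def mult_add_eq_iff)

lemma component_cell: "i < m \<Longrightarrow> b < Y \<Longrightarrow> component (cell i b) = i"
  using cell_less[of i b] by (simp add: component_def cell_def)

lemma component_control: "component (control h q) = m"
  by (simp add: component_def control_def)

lemma Delta_cellE:
  assumes "(cell i b, l, j) \<in> \<Delta>" "i < m" "b < Y"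
  obtains h q a where "l = letter h q a" "i \<noteq> h" "h < m" "q < Q" "a < Y" "q \<noteq> 1" "q \<noteq> 2" "j = cell i b"
  | q q' a' d where "l = letter i q b" "q < Q" "q \<noteq> 1" "q \<noteq> 2" "tm_next M q b = (q', a', d)" "j = cell i a'"
  using assms(1) by (cases rule: \<Delta>.cases) (use assms cell_neq_control in \<open>auto simp: cell_eq_iff\<close>)

lemma Delta_controlE:
  assumes "(control h q, l, j) \<in> \<Delta>" "q < Q"
  obtains a q' a' d where "h < m" "l = letter h q a" "q \<noteq> 1" "q \<noteq> 2" "a < Y" "tm_next M q a = (q', a', d)"
    "j = control (move_head d h) q'" "move_head d h < m"
  using assms(1) by (cases rule: \<Delta>.cases) (use assms cell_neq_control in \<open>auto simp: control_eq_iff\<close>)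

text \<open>The state of automaton \<open>c\<close> at time \<open>t\<close>; automaton
  \<open>m\<close> is the control.\<close>

definition config :: "nat \<Rightarrow> nat \<Rightarrow> nat" where
  "config t c = (if c < m then cell c (content t c) else control (head t) (state t))"

lemma I_eq: "I = config 0 ` {..m}"
proof -
  have "{..m} = insert m {..<m}" by auto
  then show ?thesis by (auto simp: I_def config_def run_0 image_iff)
qed

lemma Delta_config:
  assumes "state t \<noteq> 1" "state t \<noteq> 2"
  shows "(config t c, letter (head t) (state t) (content t (head t)), config (Suc t) c) \<in> \<Delta>"
proof -
  obtain q' a' d where nx: "tm_next M (state t) (content t (head t)) = (q', a', d)"
    by (metis prod_cases3)
  note S = run_Suc[OF assms nx] and less = head_less[of t] state_less[of t] content_less[of t]
  have "move_head d (head t) < m" using head_less[of "Suc t"] S by simp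
  then show ?thesis
    using S less assms nx stays[of c "head t" "content t c" "state t" "content t (head t)"]
      writes[of "head t" "state t" "content t (head t)"] moves[of "head t" "state t" "content t (head t)"]
    by (auto simp: config_def)
qed

text \<open>The control automaton forces the position and state claimed by the letter, and the
  automaton of the scanned cell forces the symbol.\<close>

lemma Delta_config_letter:
  assumes "\<And>c. c \<le> m \<Longrightarrow> \<exists>j. (config t c, l, j) \<in> \<Delta>"
  shows "state t \<noteq> 1" "state t \<noteq> 2" "l = letter (head t) (state t) (content t (head t))"
proof -
  note less = head_less[of t] state_less[of t] content_less[of t]
  obtain j where "(control (head t) (state t), l, j) \<in> \<Delta>"
    using assms[of m] by (auto simp: config_def)
  then obtain a where a: "l = letter (head t) (state t) a" "state t \<noteq> 1" "state t \<noteq> 2" "a < Y"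
    by (rule Delta_controlE) (use less in auto)
  obtain j' where "(cell (head t) (content t (head t)), l, j') \<in> \<Delta>"
    using assms[of "head t"] less by (auto simp: config_def)
  then have "a = content t (head t)"
    by (rule Delta_cellE) (use less a in \<open>auto simp: letter_eq_iff\<close>)
  then show "state t \<noteq> 1" "state t \<noteq> 2" "l = letter (head t) (state t) (content t (head t))"
    using a by auto
qed

lemma Delta_det:
  assumes "(i, a, j) \<in> \<Delta>" "(i, a, j') \<in> \<Delta>"
  shows "j = j'"
  using assms(1)
proof (cases rule: \<Delta>.cases)
  case (stays i h b q a)
  with assms(2) have "(cell i b, letter h q a, j') \<in> \<Delta>" by simp
  then show ?thesis using stays(4,7)
    by (rule Delta_cellE) (use stays in \<open>auto simp: letter_eq_iff\<close>)
next
  case (writes h q a q' a' d)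
  with assms(2) have "(cell h a, letter h q a, j') \<in> \<Delta>" by simp
  then show ?thesis using writes(4,8)
    by (rule Delta_cellE) (use writes in \<open>auto simp: letter_eq_iff\<close>)
next
  case (moves h q a q' a' d)
  with assms(2) have "(control h q, letter h q a, j') \<in> \<Delta>" by simp
  then show ?thesis using moves(5)
    by (rule Delta_controlE) (use moves in \<open>auto simp: letter_eq_iff\<close>)
qed

text \<open>A letter that all automata can read is the one of the next step, so the word retraces
  the run. At its end the control state is final, that is, rejecting.\<close>

lemma common_word_imp_reject:
  assumes "\<And>c. c \<le> m \<Longrightarrow> \<exists>f\<in>F. path \<Delta> (config t c) w f"
  shows "\<exists>t. state t = 2"
  using assms
proof (induction w arbitrary: t)
  case Nil
  obtain f where "f \<in> F" "path \<Delta> (config t m) [] f" using Nil[of m] by auto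
  then have "control (head t) (state t) \<in> F" by (auto simp: config_def elim: path.cases)
  then have "state t = 2"
    using cell_neq_control Q_ge state_less[of t] by (auto simp: F_def control_eq_iff)
  then show ?case by blast
next
  case (Cons l w)
  have ex: "\<exists>j. (config t c, l, j) \<in> \<Delta> \<and> (\<exists>f\<in>F. path \<Delta> j w f)" if c: "c \<le> m" for c
  proof -
    obtain f where "f \<in> F" "path \<Delta> (config t c) (l # w) f" using Cons.prems[OF c] by blast
    from this(2,1) show ?thesis by (cases rule: path.cases) auto
  qed
  have l: "state t \<noteq> 1" "state t \<noteq> 2" "l = letter (head t) (state t) (content t (head t))"
    using Delta_config_letter[of t l] ex by blast+
  have "\<exists>f\<in>F. path \<Delta> (config (Suc t) c) w f" if c: "c \<le> m" for c
    using ex[OF c] Delta_det[OF Delta_config[OF l(1,2), of c]] l(3) by blast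
  then show ?case by (rule Cons.IH)
qed

lemma reject_imp_common_word:
  "state (t + d) = 2 \<Longrightarrow> \<exists>w. \<forall>c\<le>m. \<exists>f\<in>F. path \<Delta> (config t c) w f"
proof (induction d arbitrary: t)
  case 0
  then have "config t c \<in> F" for c
    using content_less[of t c] head_less[of t] by (auto simp: config_def F_def)
  then show ?case by (intro exI[of _ "[]"]) (blast intro: path_Nil)
next
  case (Suc d)
  show ?case
  proof (cases "state t = 1 \<or> state t = 2")
    case True
    then have "state t = 2" using state_absorbing[of t "Suc d"] Suc.prems by auto
    then have "config t c \<in> F" for c
      using content_less[of t c] head_less[of t] by (auto simp: config_def F_def)
    then show ?thesis by (intro exI[of _ "[]"]) (blast intro: path_Nil)
  next
    case False
    from Suc.IH[of "Suc t"] Suc.prems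
    obtain w where w: "\<forall>c\<le>m. \<exists>f\<in>F. path \<Delta> (config (Suc t) c) w f" by auto
    let ?l = "letter (head t) (state t) (content t (head t))"
    have "\<forall>c\<le>m. \<exists>f\<in>F. path \<Delta> (config t c) (?l # w) f"
      using w Delta_config[of t] False by (blast intro: path_Cons)
    then show ?thesis by blast
  qed
qed

lemma common_word_iff: "(\<exists>w. \<forall>j\<in>I. \<exists>f\<in>F. path \<Delta> j w f) \<longleftrightarrow> (\<exists>t. state t = 2)"
proof
  assume "\<exists>w. \<forall>j\<in>I. \<exists>f\<in>F. path \<Delta> j w f"
  then show "\<exists>t. state t = 2" using common_word_imp_reject[of 0] by (auto simp: I_eq)
next
  assume "\<exists>t. state t = 2"
  then show "\<exists>w. \<forall>j\<in>I. \<exists>f\<in>F. path \<Delta> j w f" using reject_imp_common_word[of 0] by (fastforce simp: I_eq)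
qed

text \<open>The pairs \<open>(j, j\<^sup>2)\<close> form a Sidon set, and \<open>B\<close> is large enough to read off both entries.\<close>

lemma sidon:
  assumes "i < n" "j < n" "i' < n" "j' < n" "p i + p j = p i' + p j'" "i \<noteq> i'"
  shows "i = j' \<and> j = i'"
proof -
  have sq: "k * k < n * n" if "k < n" for k :: nat using that by (simp add: mult_strict_mono')
  have "(i + j) * B + (i * i + j * j) = (i' + j') * B + (i' * i' + j' * j')"
    using assms(5) by (simp add: p_def algebra_simps)
  moreover have "i * i + j * j < B" "i' * i' + j' * j' < B"
    using sq[OF assms(1)] sq[OF assms(2)] sq[OF assms(3)] sq[OF assms(4)] by (simp_all add: B_def)
  ultimately have eq: "i + j = i' + j'" "i * i + j * j = i' * i' + j' * j'"
    by (simp_all add: mult_add_eq_iff)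
  define a b c d where "a = int i" "b = int j" "c = int i'" "d = int j'"
  note abcd = this
  have "a + b = c + d" using eq(1) by (simp add: abcd flip: of_nat_add)
  moreover have "a * a + b * b = c * c + d * d"
    using eq(2) by (simp add: abcd flip: of_nat_add of_nat_mult)
  \<comment> \<open>Substituting \<open>b = c + d - a\<close> into the equation of squares leaves
    twice this product; integers are used because \<open>a - c\<close> may be negative.\<close>
  ultimately have "(a - c) * (a - d) = 0" by algebra
  then have "a = d" using assms(6) by (auto simp: abcd)
  then show ?thesis using eq(1) by (simp add: abcd)
qed

text \<open>One automaton for each of the \<open>m\<close> cells and one for the control make
  \<open>m + 1\<close>, so the parameter \<open>k\<close> becomes \<open>m\<close>.\<close>

sublocale automata_code p N n m \<Delta> I F component
proof
  show "0 < p i" for i by (simp add: p_def)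
  show "p i < N" if "i < n" for i
  proof -
    have "i * B \<le> n * B" "i * i \<le> n * n" using that by (auto intro: mult_le_mono)
    then show ?thesis unfolding p_def N_def by linarith
  qed
  show "i = j' \<and> j = i'" if "i < n" "j < n" "i' < n" "j' < n" "p i + p j = p i' + p j'" "i \<noteq> i'" for i j i' j'
    using sidon that by blast
  have letter_bound: "letter h q a < 3 + m * Q * Y" if "h < m" "q < Q" "a < Y" for h q a
    using that by (simp add: letter_def mult_add_less)
  have "\<Delta> \<subseteq> {..<n} \<times> {..<3 + m * Q * Y} \<times> {..<n}"
    by (auto elim!: \<Delta>.cases intro!: letter_bound cell_less_n control_less_n dest: tm_next_range)
  then show "finite \<Delta>" by (rule finite_subset) simp
  show "i < n \<and> j < n \<and> 3 \<le> a" if "(i, a, j) \<in> \<Delta>" for i a j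
  proof -
    have le: "3 \<le> letter h q a" for h q a by (simp add: letter_def)
    show ?thesis
      using that by (cases rule: \<Delta>.cases) (auto intro: cell_less_n control_less_n le dest: tm_next_range)
  qed
  show "j = j'" if "(i, a, j) \<in> \<Delta>" "(i, a, j') \<in> \<Delta>" for i a j j'
    using that by (rule Delta_det)
  show "component j = component i" if "(i, a, j) \<in> \<Delta>" for i a j
    using that
  proof (cases rule: \<Delta>.cases)
    case (writes h q b q' b' d)
    then have "b' < Y" using tm_next_range by blast
    then show ?thesis using writes(1,3,4,8) component_cell by simp
  qed (simp_all add: component_control)
  show "F \<subseteq> {..<n}"
    using Q_ge by (auto simp: F_def intro!: cell_less_n control_less_n)
  have less: "tape_of x i < Y" for i using Y_ge by (auto simp: tape_of_def)
  then show "I \<subseteq> {..<n}"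
    using Q_ge m_pos by (auto simp: I_def intro!: cell_less_n control_less_n)
  have comp: "component (config 0 c) = c" if "c \<le> m" for c
    using that less by (auto simp: config_def run_0 component_cell component_control)
  show "inj_on component I"
    unfolding I_eq by (auto simp: inj_on_def comp)
  have "inj_on (config 0) {..m}" by (rule inj_on_inverseI[of _ component]) (simp add: comp)
  then show "card I = Suc m" unfolding I_eq by (simp add: card_image)
  show "0 < m" by (rule m_pos)
qed

theorem k_free_iff_not_reject: "k_free (gen_mat ` T) m \<longleftrightarrow> (\<nexists>t. state t = 2)"
  using k_free_iff_no_common_word common_word_iff by simp

end

section \<open>Counter machines\<close>

datatype cond = Zero nat | Symbol nat
datatype instr = Inc nat | Dec nat | InL | InR | Out bool | JIf cond nat | Jmp int

text \<open>A state consists of the position of the input head, the registers and the output.\<close>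

type_synonym cstate = "nat \<times> (nat \<Rightarrow> nat) \<times> bool list"

fun holds :: "bool list \<Rightarrow> cond \<Rightarrow> cstate \<Rightarrow> bool" where
  "holds x (Zero r) (h, R, w) \<longleftrightarrow> R r = 0"
| "holds x (Symbol s) (h, R, w) \<longleftrightarrow> tape_of x h = s"

fun instr_step :: "bool list \<Rightarrow> instr \<Rightarrow> nat \<times> cstate \<Rightarrow> nat \<times> cstate" where
  "instr_step x (Inc r) (pc, h, R, w) = (Suc pc, h, R(r := Suc (R r)), w)"
| "instr_step x (Dec r) (pc, h, R, w) = (Suc pc, h, R(r := R r - 1), w)"
| "instr_step x InL (pc, h, R, w) = (Suc pc, h - 1, R, w)"
| "instr_step x InR (pc, h, R, w) = (Suc pc, Suc h, R, w)"
| "instr_step x (Out b) (pc, h, R, w) = (Suc pc, h, R, w @ [b])"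
| "instr_step x (JIf c d) (pc, s) = ((if holds x c s then Suc pc + d else Suc pc), s)"
| "instr_step x (Jmp d) (pc, s) = (nat (int pc + d), s)"

definition prog_step :: "bool list \<Rightarrow> instr list \<Rightarrow> nat \<times> cstate \<Rightarrow> nat \<times> cstate" where
  "prog_step x P c = (if fst c < length P then instr_step x (P ! fst c) c else c)"

text \<open>Jumps are relative, so a fragment works wherever it stands, and quantifying over the
  surrounding code makes fragments composable. \<open>T\<close> is an upper bound because branches
  take different times.\<close>

definition runs :: "bool list \<Rightarrow> instr list \<Rightarrow> cstate \<Rightarrow> nat \<Rightarrow> cstate \<Rightarrow> bool" where
  "runs x P s T s' \<longleftrightarrow> (\<forall>pre post. \<exists>t\<le>T.
     (prog_step x (pre @ P @ post) ^^ t) (length pre, s) = (length pre + length P, s'))"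

lemma runs_mono: "runs x P s T s' \<Longrightarrow> T \<le> T' \<Longrightarrow> runs x P s T' s'"
  unfolding runs_def by (meson le_trans)

lemma runs_append:
  assumes "runs x P s T s'" "runs x P' s' T' s''"
  shows "runs x (P @ P') s (T + T') s''"
  unfolding runs_def
proof (intro allI)
  fix pre post :: "instr list"
  obtain t where t: "t \<le> T"
    "(prog_step x (pre @ (P @ P') @ post) ^^ t) (length pre, s) = (length pre + length P, s')"
    using assms(1)[unfolded runs_def, rule_format, of pre "P' @ post"] by auto
  obtain t' where t': "t' \<le> T'"
    "(prog_step x (pre @ (P @ P') @ post) ^^ t') (length pre + length P, s') =
       (length pre + length (P @ P'), s'')"
    using assms(2)[unfolded runs_def, rule_format, of "pre @ P" post] by (auto simp: add.assoc)
  have "(prog_step x (pre @ (P @ P') @ post) ^^ (t' + t)) (length pre, s) = (length pre + length (P @ P'), s'')"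
    using t t' by (simp add: funpow_add)
  then show "\<exists>t\<le>T + T'. (prog_step x (pre @ (P @ P') @ post) ^^ t) (length pre, s) =
      (length pre + length (P @ P'), s'')"
    using t t' by (intro exI[of _ "t' + t"]) auto
qed

lemma runs_Nil: "runs x [] s 0 s"
  unfolding runs_def by simp

lemma runs_instr:
  assumes "\<And>pc. instr_step x i (pc, s) = (Suc pc, s')"
  shows "runs x [i] s 1 s'"
  unfolding runs_def
proof (intro allI)
  fix pre post :: "instr list"
  have "prog_step x (pre @ [i] @ post) (length pre, s) = (length pre + length [i], s')"
    using assms by (simp add: prog_step_def)
  then show "\<exists>t\<le>1. (prog_step x (pre @ [i] @ post) ^^ t) (length pre, s) = (length pre + length [i], s')"
    by (intro exI[of _ 1]) auto
qed

lemma runs_Inc: "runs x [Inc r] (h, R, w) 1 (h, R(r := Suc (R r)), w)"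
  and runs_Dec: "runs x [Dec r] (h, R, w) 1 (h, R(r := R r - 1), w)"
  and runs_InL: "runs x [InL] (h, R, w) 1 (h - 1, R, w)"
  and runs_InR: "runs x [InR] (h, R, w) 1 (Suc h, R, w)"
  and runs_Out: "runs x [Out b] (h, R, w) 1 (h, R, w @ [b])"
  by (rule runs_instr; simp)+

definition unless :: "cond \<Rightarrow> instr list \<Rightarrow> instr list" where
  "unless c P = JIf c (length P) # P"

text \<open>The closing jump goes back over the body to the test in front of it.\<close>

definition until :: "cond \<Rightarrow> instr list \<Rightarrow> instr list" where
  "until c P = unless c (P @ [Jmp (- int (length P) - 1)])"

text \<open>The code of the negative branch \<open>P'\<close> comes first; its closing jump skips
  \<open>P\<close>.\<close>

definition if_then_else :: "cond \<Rightarrow> instr list \<Rightarrow> instr list \<Rightarrow> instr list" where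
  "if_then_else c P P' = unless c (P' @ [Jmp (int (length P) + 1)]) @ P"

lemma runs_unless_skip: "holds x c s \<Longrightarrow> runs x (unless c P) s 1 s"
  unfolding runs_def unless_def by (intro allI exI[of _ 1]) (simp add: prog_step_def)

lemma runs_unless:
  assumes "\<not> holds x c s" "runs x P s T s'"
  shows "runs x (unless c P) s (Suc T) s'"
proof -
  have "runs x [JIf c (length P)] s 1 s" using assms(1) by (intro runs_instr) simp
  from runs_append[OF this assms(2)] show ?thesis by (simp add: unless_def)
qed

lemma runs_until_stop: "holds x c s \<Longrightarrow> runs x (until c P) s 1 s"
  unfolding until_def by (rule runs_unless_skip)

lemma runs_until_step:
  assumes "\<not> holds x c s" "runs x P s T s'" "runs x (until c P) s' T' s''"
  shows "runs x (until c P) s (T + T' + 2) s''"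
  unfolding runs_def
proof (intro allI)
  fix pre post :: "instr list"
  let ?W = "until c P" and ?J = "Jmp (- int (length P) - 1)" and ?n = "length pre"
  let ?st = "prog_step x (pre @ ?W @ post)"
  have W: "?W = JIf c (Suc (length P)) # P @ [?J]" by (simp add: until_def unless_def)
  have 1: "?st (?n, s) = (Suc ?n, s)" using assms(1) by (simp add: prog_step_def W)
  obtain t where t: "t \<le> T" "(?st ^^ t) (Suc ?n, s) = (Suc ?n + length P, s')"
    using assms(2)[unfolded runs_def, rule_format, of "pre @ [JIf c (Suc (length P))]" "?J # post"]
    by (auto simp: W)
  have 2: "?st (Suc ?n + length P, s') = (?n, s')"
    by (simp add: prog_step_def W nth_append)
  obtain t' where t': "t' \<le> T'" "(?st ^^ t') (?n, s') = (?n + length ?W, s'')"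
    using assms(3) unfolding runs_def by blast
  have "(?st ^^ (t' + (1 + (t + 1)))) (?n, s) = (?n + length ?W, s'')"
    unfolding funpow_add using 1 2 t t' by simp
  then show "\<exists>t\<le>T + T' + 2. (?st ^^ t) (?n, s) = (?n + length ?W, s'')"
    using t t' by (intro exI[of _ "t' + (1 + (t + 1))"]) auto
qed

lemma runs_if_true:
  assumes "holds x c s" "runs x P s T s'"
  shows "runs x (if_then_else c P P') s (T + 1) s'"
  using runs_append[OF runs_unless_skip[OF assms(1)] assms(2)]
  by (simp add: if_then_else_def add.commute)

lemma runs_if_false:
  assumes "\<not> holds x c s" "runs x P' s T s'"
  shows "runs x (if_then_else c P P') s (T + 2) s'"
  unfolding runs_def
proof (intro allI)
  fix pre post :: "instr list"
  let ?J = "Jmp (int (length P) + 1)" and ?n = "length pre" and ?W = "if_then_else c P P'"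
  let ?st = "prog_step x (pre @ ?W @ post)"
  have W: "?W = JIf c (Suc (length P')) # P' @ ?J # P" by (simp add: if_then_else_def unless_def)
  have 1: "?st (?n, s) = (Suc ?n, s)" using assms(1) by (simp add: prog_step_def W)
  obtain t where t: "t \<le> T" "(?st ^^ t) (Suc ?n, s) = (Suc ?n + length P', s')"
    using assms(2)[unfolded runs_def, rule_format, of "pre @ [JIf c (Suc (length P'))]" "?J # P @ post"]
    by (auto simp: W)
  have 2: "?st (Suc ?n + length P', s') = (?n + length ?W, s')"
    by (simp add: prog_step_def W nth_append)
  have "(?st ^^ (1 + (t + 1))) (?n, s) = (?n + length ?W, s')"
    unfolding funpow_add using 1 2 t by simp
  then show "\<exists>t\<le>T + 2. (?st ^^ t) (?n, s) = (?n + length ?W, s')"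
    using t by (intro exI[of _ "1 + (t + 1)"]) auto
qed

section \<open>Simulation of counter machines by multi-tape machines\<close>

fun regs :: "instr \<Rightarrow> nat set" where
  "regs (Inc r) = {r}"
| "regs (Dec r) = {r}"
| "regs (JIf (Zero r) d) = {r}"
| "regs _ = {}"

text \<open>Registers are head positions. A mark in cell 0 makes zero detectable. Tape 0 holds the input
  and tape \<open>K + 1\<close> the output.\<close>

definition keep :: "nat list \<Rightarrow> (nat \<times> dir) list" where
  "keep = map (\<lambda>s. (s, MoveN))"

text \<open>States 0, 1 and 2 are reserved, so instruction \<open>pc\<close> becomes state
  \<open>3 + pc\<close>. Running off the program means acceptance.\<close>

definition pc_state :: "instr list \<Rightarrow> nat \<Rightarrow> nat" where
  "pc_state P pc = (if pc < length P then 3 + pc else 1)"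

text \<open>A left move in cell 0 leaves the head in place, which is exactly the truncated
  subtraction demanded by \<open>Dec\<close> and \<open>InL\<close>.\<close>

fun instr_trans :: "nat \<Rightarrow> instr \<Rightarrow> nat \<Rightarrow> nat list \<Rightarrow> nat \<times> (nat \<times> dir) list" where
  "instr_trans K (Inc r) pc rs = (Suc pc, (keep rs)[Suc r := (rs ! Suc r, MoveR)])"
| "instr_trans K (Dec r) pc rs = (Suc pc, (keep rs)[Suc r := (rs ! Suc r, MoveL)])"
| "instr_trans K InL pc rs = (Suc pc, (keep rs)[0 := (rs ! 0, MoveL)])"
| "instr_trans K InR pc rs = (Suc pc, (keep rs)[0 := (rs ! 0, MoveR)])"
| "instr_trans K (Out b) pc rs = (Suc pc, (keep rs)[Suc K := (if b then 2 else 1, MoveR)])"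
| "instr_trans K (JIf (Zero r) d) pc rs = ((if rs ! Suc r = 1 then Suc pc + d else Suc pc), keep rs)"
| "instr_trans K (JIf (Symbol s) d) pc rs = ((if rs ! 0 = s then Suc pc + d else Suc pc), keep rs)"
| "instr_trans K (Jmp d) pc rs = (nat (int pc + d), keep rs)"

text \<open>State 0 spends one step on writing the marks on the register tapes 1 to
  \<open>K\<close>.\<close>

definition machine_trans :: "nat \<Rightarrow> instr list \<Rightarrow> nat \<Rightarrow> nat list \<Rightarrow> nat \<times> (nat \<times> dir) list" where
  "machine_trans K P q rs =
     (if q = 0 then (pc_state P 0, map (\<lambda>i. (if 0 < i \<and> i \<le> K then 1 else rs ! i, MoveN)) [0..<K + 2])
      else if q < 3 then (q, keep rs)
      else case instr_trans K (P ! (q - 3)) (q - 3) rs of (pc, as) \<Rightarrow> (pc_state P pc, as))"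

definition machine :: "nat \<Rightarrow> instr list \<Rightarrow> tm" where
  "machine K P = \<lparr>n_tapes = K + 2, n_states = length P + 3, n_syms = 3, trans_fun = machine_trans K P\<rparr>"

definition mark :: "nat \<Rightarrow> nat" where "mark = (\<lambda>_. 0)(0 := 1)"

definition tapes :: "bool list \<Rightarrow> nat \<Rightarrow> cstate \<Rightarrow> tape list" where
  "tapes x K = (\<lambda>(h, R, w). (tape_of x, h) # map (\<lambda>r. (mark, R r)) [0..<K] @ [(tape_of w, length w)])"

definition reads :: "tape list \<Rightarrow> nat list" where "reads = map (\<lambda>(t, h). t h)"

lemma length_keep [simp]: "length (keep rs) = length rs"
  by (simp add: keep_def)

lemma instr_trans_wf:
  assumes "instr_trans K i pc rs = (pc', as)" "length rs = K + 2" "set rs \<subseteq> {..<3}"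
    and "\<forall>r\<in>regs i. r < K"
  shows "length as = K + 2 \<and> fst ` set as \<subseteq> {..<3}"
proof -
  have rs: "rs ! j < 3" if "j < K + 2" for j
    using subsetD[OF assms(3) nth_mem[of j rs]] assms(2) that by simp
  have kp: "fst ` set (keep rs) \<subseteq> {..<3}" using assms(3) by (auto simp: keep_def)
  have upd: "fst ` set ((keep rs)[j := (a, d)]) \<subseteq> {..<3}" if "a < 3" for j a d
    using set_update_subset_insert[of "keep rs" j "(a, d)"] kp that by fastforce
  have "length (snd (instr_trans K i pc rs)) = K + 2 \<and> fst ` set (snd (instr_trans K i pc rs)) \<subseteq> {..<3}"
  proof (cases i)
    case (JIf c d)
    then show ?thesis using assms(2) kp by (cases c) simp_all
  qed (use assms(2,4) kp upd rs in simp_all)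
  then show ?thesis using assms(1) by simp
qed

lemma wf_machine:
  assumes "\<forall>i\<in>set P. \<forall>r\<in>regs i. r < K"
  shows "wf_tm (machine K P)"
proof -
  have pc: "pc_state P pc < length P + 3" for pc by (simp add: pc_state_def)
  have "q' < length P + 3 \<and> length as = K + 2 \<and> fst ` set as \<subseteq> {..<3}"
    if "q < length P + 3" "length rs = K + 2" "set rs \<subseteq> {..<3}" "machine_trans K P q rs = (q', as)"
    for q rs q' as
  proof -
    have rs: "rs ! j < 3" if "j < K + 2" for j
      using subsetD[OF \<open>set rs \<subseteq> {..<3}\<close> nth_mem[of j rs]] \<open>length rs = K + 2\<close> that by simp
    consider "q = 0" | "q \<noteq> 0" "q < 3" | "3 \<le> q" by linarith
    then show ?thesis
    proof cases
      case 1
      then show ?thesis using that pc rs by (auto simp: machine_trans_def)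
    next
      case 2
      then show ?thesis using that by (auto simp: machine_trans_def keep_def)
    next
      case 3
      obtain pc' as' where tr: "instr_trans K (P ! (q - 3)) (q - 3) rs = (pc', as')" by force
      have "P ! (q - 3) \<in> set P" using that(1) 3 by simp
      then show ?thesis
        using instr_trans_wf[OF tr that(2,3)] assms that(4) 3 tr pc by (auto simp: machine_trans_def)
    qed
  qed
  then show ?thesis by (simp add: wf_tm_def machine_def)
qed

lemma length_tapes: "length (tapes x K s) = K + 2"
  by (cases s) (simp add: tapes_def)

lemma map2_keep: "map2 tape_act ts (keep (reads ts)) = ts"
  by (induction ts) (auto simp: keep_def reads_def)

text \<open>An instruction changes at most one tape, so its effect is the update of one list
  entry.\<close>

lemma map2_keep_update:
  assumes "j < length ts"
  shows "map2 tape_act ts ((keep (reads ts))[j := a]) = ts[j := tape_act (ts ! j) a]"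
proof -
  have "zip ts ((keep (reads ts))[j := a]) = (zip ts (keep (reads ts)))[j := (ts ! j, a)]"
    using zip_update[of ts j "ts ! j" "keep (reads ts)" a] by simp
  then show ?thesis
    using map2_keep[of ts] by (simp add: map_update)
qed

lemma tapes_nth:
  "tapes x K (h, R, w) ! 0 = (tape_of x, h)"
  "r < K \<Longrightarrow> tapes x K (h, R, w) ! Suc r = (mark, R r)"
  "tapes x K (h, R, w) ! Suc K = (tape_of w, length w)"
  by (simp_all add: tapes_def nth_append)

lemma reads_nth:
  "reads (tapes x K (h, R, w)) ! 0 = tape_of x h"
  "r < K \<Longrightarrow> reads (tapes x K (h, R, w)) ! Suc r = mark (R r)"
  by (simp_all add: reads_def tapes_nth length_tapes)

lemma tapes_update:
  "(tapes x K (h, R, w))[0 := (tape_of x, h')] = tapes x K (h', R, w)"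
  "r < K \<Longrightarrow> (tapes x K (h, R, w))[Suc r := (mark, v)] = tapes x K (h, R(r := v), w)"
  "(tapes x K (h, R, w))[Suc K := (tape_of (w @ [b]), Suc (length w))] = tapes x K (h, R, w @ [b])"
  by (auto simp: tapes_def list_update_append nth_list_update intro!: nth_equalityI)

lemma tape_act_out:
  "tape_act (tape_of w, length w) (2, MoveR) = (tape_of (w @ [True]), Suc (length w))"
  "tape_act (tape_of w, length w) (Suc 0, MoveR) = (tape_of (w @ [False]), Suc (length w))"
  by (auto simp: tape_of_def nth_append fun_eq_iff)

lemma mark_eq_1_iff: "mark v = Suc 0 \<longleftrightarrow> v = 0"
  by (simp add: mark_def)

lemma fun_upd_same_tape: "tape_act (t, h) (t h, d) = (t, move_head d h)"
  by simp

lemma machine_step: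
  assumes "pc < length P" "\<forall>r\<in>regs (P ! pc). r < K" "instr_step x (P ! pc) (pc, s) = (pc', s')"
  shows "tm_step (machine K P) (pc_state P pc, tapes x K s) = (pc_state P pc', tapes x K s')"
proof -
  obtain h R w where s: "s = (h, R, w)" by (cases s)
  let ?ts = "tapes x K s"
  have "length ?ts = K + 2" by (rule length_tapes)
  then have upd: "j < K + 2 \<Longrightarrow> map2 tape_act ?ts ((keep (reads ?ts))[j := a]) = ?ts[j := tape_act (?ts ! j) a]" for j a
    using map2_keep_update[of j ?ts a] by simp
  obtain pc1 as where tr: "instr_trans K (P ! pc) pc (reads ?ts) = (pc1, as)" by force
  have "tm_step (machine K P) (pc_state P pc, ?ts) = (pc_state P pc1, map2 tape_act ?ts as)"
    using assms(1) tr by (simp add: machine_def machine_trans_def pc_state_def reads_def)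
  moreover have "pc1 = pc' \<and> map2 tape_act ?ts as = tapes x K s'"
  proof (cases "P ! pc")
    case (JIf c d)
    then show ?thesis
      using assms tr by (cases c) (auto simp: s map2_keep reads_nth mark_eq_1_iff)
  qed (use assms tr in \<open>auto simp: s upd[unfolded s] map2_keep tapes_nth reads_nth tapes_update
      fun_upd_same_tape tape_act_out simp del: tape_act.simps\<close>)
  ultimately show ?thesis by simp
qed

lemma machine_steps:
  assumes "\<forall>i\<in>set P. \<forall>r\<in>regs i. r < K" "(prog_step x P ^^ t) (pc, s) = (pc', s')"
  shows "(tm_step (machine K P) ^^ t) (pc_state P pc, tapes x K s) = (pc_state P pc', tapes x K s')"
  using assms(2)
proof (induction t arbitrary: pc' s')
  case (Suc t)
  obtain pc1 s1 where 1: "(prog_step x P ^^ t) (pc, s) = (pc1, s1)"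
    by (cases "(prog_step x P ^^ t) (pc, s)")
  then have step: "prog_step x P (pc1, s1) = (pc', s')" using Suc.prems by simp
  have "tm_step (machine K P) (pc_state P pc1, tapes x K s1) = (pc_state P pc', tapes x K s')"
  proof (cases "pc1 < length P")
    case True
    then have "\<forall>r\<in>regs (P ! pc1). r < K" using assms(1) nth_mem by blast
    then show ?thesis using machine_step[OF True] step True by (simp add: prog_step_def)
  next
    case False
    then show ?thesis using step by (auto simp: prog_step_def pc_state_def)
  qed
  then show ?case using Suc.IH[OF 1] by simp
qed simp

lemma machine_start:
  "tm_step (machine K P) (init_config (machine K P) x) = (pc_state P 0, tapes x K (0, \<lambda>_. 0, []))"
proof -
  have "init_config (machine K P) x = (0, (tape_of x, 0) # replicate (Suc K) (\<lambda>_. 0, 0))"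
    by (simp add: init_config_def machine_def)
  moreover have "map2 tape_act ((tape_of x, 0) # replicate (Suc K) (\<lambda>_. 0, 0))
      (map (\<lambda>i. (if 0 < i \<and> i \<le> K then 1
         else map (\<lambda>(t, h). t h) ((tape_of x, 0) # replicate (Suc K) (\<lambda>_. 0, 0)) ! i, MoveN)) [0..<K + 2])
    = tapes x K (0, \<lambda>_. 0, [])" (is "?L = ?R")
  proof (rule nth_equalityI)
    show len: "length ?L = length ?R" by (simp add: length_tapes)
    fix i assume "i < length ?L"
    then consider "i = 0" | r where "i = Suc r" "r < K" | "i = Suc K"
      by (cases i) (auto simp: less_Suc_eq)
    then show "?L ! i = ?R ! i"
      by cases (auto simp: tapes_nth mark_def tape_of_def nth_append simp del: upt_Suc replicate_Suc)
  qed
  ultimately show ?thesis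
    by (simp add: machine_def machine_trans_def del: upt_Suc replicate_Suc list.map(2))
qed

text \<open>With empty surrounding code the fragment is the whole program, and reaching its end is
  acceptance. The extra step writes the marks.\<close>

theorem runs_imp_computes:
  assumes "\<forall>i\<in>set P. \<forall>r\<in>regs i. r < K"
    and "\<And>x. \<exists>h R. runs x P (0, \<lambda>_. 0, []) (T (length x)) (h, R, f x)"
  shows "computes_in_time (machine K P) f (\<lambda>n. Suc (T n))"
  unfolding computes_in_time_def
proof
  fix x
  obtain h R where "runs x P (0, \<lambda>_. 0, []) (T (length x)) (h, R, f x)" using assms(2) by blast
  then obtain t where t: "t \<le> T (length x)"
    "(prog_step x P ^^ t) (0, (0, \<lambda>_. 0, [])) = (length P, (h, R, f x))"
    unfolding runs_def by (metis append_Nil append_Nil2 list.size(3) add_0)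
  have "tm_run (machine K P) x (Suc t) = (1, tapes x K (h, R, f x))"
    using machine_steps[OF assms(1) t(2)] machine_start
    by (simp add: tm_run_def funpow_Suc_right pc_state_def del: funpow.simps)
  then show "\<exists>t\<le>Suc (T (length x)). fst (tm_run (machine K P) x t) = 1 \<and>
      fst (last (snd (tm_run (machine K P) x t))) = tape_of (f x)"
    using t(1) by (intro exI[of _ "Suc t"]) (simp add: tapes_def)
qed

section \<open>Printing lists of generators in polynomial time\<close>

text \<open>The base \<open>N + 2\<close> is at least 2 even for \<open>N = 0\<close>, so constants
  and sums are absorbed by a larger exponent; the bound is monotone, which makes composition
  work.\<close>

definition poly_bounded :: "(nat \<Rightarrow> nat) \<Rightarrow> bool" where
  "poly_bounded f \<longleftrightarrow> (\<exists>k. \<forall>N. f N \<le> (N + 2) ^ k)"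

lemma poly_bounded_const: "poly_bounded (\<lambda>N. c)"
proof -
  have "c \<le> (N + 2) ^ c" for N :: nat
    using less_exp[of c] power_mono[of 2 "N + 2" c] by linarith
  then show ?thesis unfolding poly_bounded_def by blast
qed

lemma poly_bounded_id: "poly_bounded (\<lambda>N. N)"
  unfolding poly_bounded_def by (rule exI[of _ 1]) simp

lemma poly_bounded_add:
  assumes "poly_bounded f" "poly_bounded g"
  shows "poly_bounded (\<lambda>N. f N + g N)"
proof -
  obtain k l where kl: "\<And>N. f N \<le> (N + 2) ^ k" "\<And>N. g N \<le> (N + 2) ^ l"
    using assms unfolding poly_bounded_def by blast
  have "f N + g N \<le> (N + 2) ^ (k + l + 1)" for N
  proof -
    have "(N + 2) ^ k \<le> (N + 2) ^ (k + l)" "(N + 2) ^ l \<le> (N + 2) ^ (k + l)"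
      by (intro power_increasing; simp)+
    then have "f N + g N \<le> 2 * (N + 2) ^ (k + l)" using kl[of N] by linarith
    also have "\<dots> \<le> (N + 2) * (N + 2) ^ (k + l)" by (intro mult_right_mono) auto
    finally show ?thesis by simp
  qed
  then show ?thesis unfolding poly_bounded_def by blast
qed

lemma poly_bounded_mult:
  assumes "poly_bounded f" "poly_bounded g"
  shows "poly_bounded (\<lambda>N. f N * g N)"
proof -
  obtain k l where kl: "\<And>N. f N \<le> (N + 2) ^ k" "\<And>N. g N \<le> (N + 2) ^ l"
    using assms unfolding poly_bounded_def by blast
  have "f N * g N \<le> (N + 2) ^ (k + l)" for N
    using mult_mono[OF kl(1)[of N] kl(2)[of N]] by (simp add: power_add)
  then show ?thesis unfolding poly_bounded_def by blast
qed

lemma poly_bounded_compose: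
  assumes "poly_bounded f" "poly_bounded g"
  shows "poly_bounded (\<lambda>N. f (g N))"
proof -
  obtain k where k: "\<And>N. f N \<le> (N + 2) ^ k"
    using assms unfolding poly_bounded_def by blast
  obtain l where l: "\<And>N. g N + 2 \<le> (N + 2) ^ l"
    using poly_bounded_add[OF assms(2) poly_bounded_const[of 2]] unfolding poly_bounded_def by blast
  have "f (g N) \<le> (N + 2) ^ (l * k)" for N
    using k[of "g N"] power_mono[OF l[of N], of k] by (simp add: power_mult)
  then show ?thesis unfolding poly_bounded_def by blast
qed

lemmas poly_bounded_intros =
  poly_bounded_const poly_bounded_id poly_bounded_add poly_bounded_mult

fun straight :: "instr \<Rightarrow> bool" where
  "straight (JIf c d) = False"
| "straight (Jmp d) = False"
| "straight _ = True"

definition effect :: "bool list \<Rightarrow> instr \<Rightarrow> cstate \<Rightarrow> cstate" where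
  "effect x i s = snd (instr_step x i (0, s))"

lemma effect_simps [simp]:
  "effect x (Inc r) (h, R, w) = (h, R(r := Suc (R r)), w)"
  "effect x (Dec r) (h, R, w) = (h, R(r := R r - 1), w)"
  "effect x InL (h, R, w) = (h - 1, R, w)"
  "effect x InR (h, R, w) = (Suc h, R, w)"
  "effect x (Out b) (h, R, w) = (h, R, w @ [b])"
  by (simp_all add: effect_def)

lemma runs_straight_instr: "straight i \<Longrightarrow> runs x [i] s 1 (effect x i s)"
  using runs_Inc runs_Dec runs_InL runs_InR runs_Out by (cases s; cases i) auto

lemma runs_straight_Cons:
  assumes "straight i" "runs x P (effect x i s) T s'"
  shows "runs x (i # P) s (Suc T) s'"
  using runs_append[OF runs_straight_instr[OF assms(1)] assms(2)] by simp

lemma runs_straight: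
  assumes "\<forall>i\<in>set P. straight i" "fold (effect x) P s = s'" "T = length P"
  shows "runs x P s T s'"
  using assms
proof (induction P arbitrary: s T)
  case (Cons i P)
  have "runs x P (effect x i s) (length P) s'"
    using Cons.prems(1,2) by (intro Cons.IH) simp_all
  then have "runs x (i # P) s (Suc (length P)) s'"
    using Cons.prems(1) by (intro runs_straight_Cons) simp_all
  then show ?case using Cons.prems(3) by simp
qed (simp add: runs_Nil)

text \<open>\<open>S i\<close> is the state with \<open>i\<close> rounds still to go; to use the
  rule, one describes the state as a function of the loop counter.\<close>

lemma runs_until:
  assumes "\<And>i. i < n \<Longrightarrow> runs x P (S (Suc i)) T (S i)"
    and "\<And>i. i \<le> n \<Longrightarrow> holds x c (S i) \<longleftrightarrow> i = 0"
  shows "runs x (until c P) (S n) (n * (T + 2) + 1) (S 0)"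
  using assms
proof (induction n)
  case 0
  then show ?case using runs_until_stop[of x c "S 0" P] by simp
next
  case (Suc n)
  have "runs x (until c P) (S n) (n * (T + 2) + 1) (S 0)"
    using Suc by simp
  from runs_until_step[OF _ Suc.prems(1)[of n] this] Suc.prems(2)[of "Suc n"]
  show ?case by (simp add: algebra_simps)
qed

definition clear :: "nat \<Rightarrow> instr list" where
  "clear j = until (Zero j) [Dec j]"

definition move_reg :: "nat \<Rightarrow> nat \<Rightarrow> instr list" where
  "move_reg j t = until (Zero j) [Dec j, Inc t]"

definition sub_reg :: "nat \<Rightarrow> nat \<Rightarrow> instr list" where
  "sub_reg j t = until (Zero j) [Dec j, Dec t]"

text \<open>Reading a register means counting it down, so \<open>z\<close> keeps a copy from which
  \<open>j\<close> is restored.\<close>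

definition add_reg :: "nat \<Rightarrow> nat \<Rightarrow> nat \<Rightarrow> instr list" where
  "add_reg j t z = until (Zero j) [Dec j, Inc t, Inc z] @ move_reg z j"

lemma runs_clear: "runs x (clear j) (h, R, w) (3 * R j + 1) (h, R(j := 0), w)"
proof -
  let ?S = "\<lambda>i. (h, R(j := i), w)"
  have "runs x [Dec j] (?S (Suc i)) 1 (?S i)" for i
    by (rule runs_straight) auto
  then have "runs x (clear j) (?S (R j)) (R j * (1 + 2) + 1) (?S 0)"
    unfolding clear_def by (intro runs_until[where S = "?S"]) auto
  then have "runs x (clear j) (h, R, w) (R j * (1 + 2) + 1) (h, R(j := 0), w)" by simp
  then show ?thesis by (rule runs_mono) simp
qed

lemma runs_move_reg:
  assumes "j \<noteq> t"
  shows "runs x (move_reg j t) (h, R, w) (4 * R j + 1) (h, R(t := R t + R j, j := 0), w)"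
proof -
  let ?S = "\<lambda>i. (h, R(t := R t + (R j - i), j := i), w)"
  have "runs x [Dec j, Inc t] (?S (Suc i)) 2 (?S i)" if "i < R j" for i
    by (rule runs_straight) (use assms that in \<open>auto simp: fun_eq_iff\<close>)
  then have "runs x (move_reg j t) (?S (R j)) (R j * (2 + 2) + 1) (?S 0)"
    unfolding move_reg_def by (intro runs_until[where S = "?S"]) auto
  then show ?thesis by (simp add: mult.commute)
qed

lemma runs_sub_reg:
  assumes "j \<noteq> t"
  shows "runs x (sub_reg j t) (h, R, w) (4 * R j + 1) (h, R(t := R t - R j, j := 0), w)"
proof -
  let ?S = "\<lambda>i. (h, R(t := R t - (R j - i), j := i), w)"
  have "runs x [Dec j, Dec t] (?S (Suc i)) 2 (?S i)" if "i < R j" for i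
    by (rule runs_straight) (use assms that in \<open>auto simp: fun_eq_iff\<close>)
  then have "runs x (sub_reg j t) (?S (R j)) (R j * (2 + 2) + 1) (?S 0)"
    unfolding sub_reg_def by (intro runs_until[where S = "?S"]) auto
  then show ?thesis by (simp add: mult.commute)
qed

lemma runs_add_reg:
  assumes "j \<noteq> t" "j \<noteq> z" "t \<noteq> z" "R z = 0"
  shows "runs x (add_reg j t z) (h, R, w) (9 * R j + 2) (h, R(t := R t + R j), w)"
proof -
  let ?S = "\<lambda>i. (h, R(t := R t + (R j - i), z := R j - i, j := i), w)"
  have "runs x [Dec j, Inc t, Inc z] (?S (Suc i)) 3 (?S i)" if "i < R j" for i
    by (rule runs_straight) (use assms that in \<open>auto simp: fun_eq_iff\<close>)
  then have 1: "runs x (until (Zero j) [Dec j, Inc t, Inc z]) (?S (R j)) (R j * (3 + 2) + 1) (?S 0)"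
    by (intro runs_until[where S = "?S"]) auto
  let ?R = "R(t := R t + R j, z := R j, j := 0)"
  have "?S (R j) = (h, R, w)" using assms by (auto simp: fun_eq_iff)
  then have 1: "runs x (until (Zero j) [Dec j, Inc t, Inc z]) (h, R, w) (5 * R j + 1) (h, ?R, w)"
    using 1 by (simp add: mult.commute)
  have "?R(j := ?R j + ?R z, z := 0) = R(t := R t + R j)"
    using assms by (auto simp: fun_eq_iff)
  then have "runs x (move_reg z j) (h, ?R, w) (4 * R j + 1) (h, R(t := R t + R j), w)"
    using runs_move_reg[of z j x h ?R w] assms by auto
  from runs_append[OF 1 this] show ?thesis
    unfolding add_reg_def by (rule runs_mono) simp
qed

section \<open>Arithmetic expressions and their compilation\<close>

datatype aexp = Const nat | Var nat | Len | Input aexp | Add aexp aexp | Sub aexp aexp | Mul aexp aexp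

fun aval :: "bool list \<Rightarrow> nat list \<Rightarrow> aexp \<Rightarrow> nat" where
  "aval x env (Const k) = k"
| "aval x env (Var i) = env ! i"
| "aval x env Len = length x"
| "aval x env (Input e) = tape_of x (aval x env e)"
| "aval x env (Add e1 e2) = aval x env e1 + aval x env e2"
| "aval x env (Sub e1 e2) = aval x env e1 - aval x env e2"
| "aval x env (Mul e1 e2) = aval x env e1 * aval x env e2"

fun scoped :: "nat \<Rightarrow> aexp \<Rightarrow> bool" where
  "scoped d (Const k) = True"
| "scoped d (Var i) = (i < d)"
| "scoped d Len = True"
| "scoped d (Input e) = scoped d e"
| "scoped d (Add e1 e2) = (scoped d e1 \<and> scoped d e2)"
| "scoped d (Sub e1 e2) = (scoped d e1 \<and> scoped d e2)"
| "scoped d (Mul e1 e2) = (scoped d e1 \<and> scoped d e2)"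

lemma scoped_Suc: "scoped d e \<Longrightarrow> scoped (Suc d) e"
  by (induction e) auto

lemma aval_snoc: "scoped (length env) e \<Longrightarrow> aval x (env @ [v]) e = aval x env e"
  by (induction e) (auto simp: nth_append)

text \<open>Compiled code uses the registers as a stack.\<close>

definition stack :: "nat list \<Rightarrow> nat \<Rightarrow> nat" where
  "stack st i = (if i < length st then st ! i else 0)"

lemma stack_upd_top: "(stack st)(length st := v) = stack (st @ [v])"
  by (auto simp: stack_def fun_eq_iff nth_append)

lemma stack_upd_last: "(stack (st @ [u]))(length st := v) = stack (st @ [v])"
  by (auto simp: stack_def fun_eq_iff nth_append)

lemma stack_pop: "stack (st @ [0]) = stack st"
  by (auto simp: stack_def fun_eq_iff nth_append)

lemma stack_top: "stack st (length st) = 0" "stack (st @ [v]) (length st) = v"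
  "stack st (Suc (length st)) = 0" "stack (st @ [v]) (Suc (length st)) = 0"
  "stack st (Suc (Suc (length st))) = 0" "stack (st @ [v]) (Suc (Suc (length st))) = 0"
  "stack (st @ [u, v]) (length st) = u" "stack (st @ [u, v]) (Suc (length st)) = v"
  "stack (st @ [u, v]) (Suc (Suc (length st))) = 0" "stack (st @ [u, v]) (Suc (Suc (Suc (length st)))) = 0"
  by (auto simp: stack_def nth_append)

definition bounded_by :: "nat \<Rightarrow> bool list \<Rightarrow> nat list \<Rightarrow> bool" where
  "bounded_by N x st \<longleftrightarrow> length x \<le> N \<and> (\<forall>v\<in>set st. v \<le> N)"

lemma bounded_by_snoc: "bounded_by N x st \<Longrightarrow> v \<le> M \<Longrightarrow> bounded_by (N + M) x (st @ [v])"
  by (auto simp: bounded_by_def)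

text \<open>The code pushes the value onto a stack of height \<open>d\<close> and returns the input
  head to cell 0. Registers above the stack are 0 before and after, so they serve as scratch.
  \<open>T\<close> bounds the time and also the value, because values enter the bounds of later
  computations.\<close>

definition evaluates :: "instr list \<Rightarrow> (nat \<Rightarrow> nat) \<Rightarrow> nat \<Rightarrow> aexp \<Rightarrow> bool" where
  "evaluates P T d e \<longleftrightarrow> (\<forall>x st N w. length st = d \<longrightarrow> bounded_by N x st \<longrightarrow>
     aval x st e \<le> T N \<and> runs x P (0, stack st, w) (T N) (0, stack (st @ [aval x st e]), w))"

lemma evaluatesD:
  assumes "evaluates P T d e" "length st = d" "bounded_by N x st"
  shows "aval x st e \<le> T N" "runs x P (0, stack st, w) (T N) (0, stack (st @ [aval x st e]), w)"
  using assms unfolding evaluates_def by blast+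

text \<open>The second operand is computed with the first one on the stack, hence the bound at
  \<open>N + T1 N\<close>; \<open>P\<close> then combines the two topmost registers.\<close>

lemma evaluates_binop:
  assumes ev: "evaluates P1 T1 d e1" "evaluates P2 T2 (Suc d) e2" "scoped d e2"
    and pb: "poly_bounded T1" "poly_bounded T2" "poly_bounded T"
    and op: "\<And>x st a b N w. length st = d \<Longrightarrow> a \<le> N \<Longrightarrow> b \<le> N \<Longrightarrow> g a b \<le> T N \<and>
      runs x P (0, stack (st @ [a, b]), w) (T N) (0, stack (st @ [g a b]), w)"
    and e: "\<And>x st. aval x st e = g (aval x st e1) (aval x st e2)"
  shows "\<exists>P T. poly_bounded T \<and> evaluates P T d e"
proof -
  let ?M = "\<lambda>N. N + T1 N" and ?L = "\<lambda>N. T1 N + T2 (N + T1 N)"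
  let ?T = "\<lambda>N. T1 N + T2 (?M N) + T (?L N)"
  have "evaluates (P1 @ P2 @ P) ?T d e"
    unfolding evaluates_def
  proof (intro allI impI)
    fix x st N w assume st: "length st = d" "bounded_by N x st"
    note 1 = evaluatesD[OF ev(1) st]
    have "bounded_by (?M N) x (st @ [aval x st e1])" using bounded_by_snoc[OF st(2) 1(1)] .
    from evaluatesD[OF ev(2) _ this] st(1) have 2: "aval x st e2 \<le> T2 (?M N)"
      "\<And>w. runs x P2 (0, stack (st @ [aval x st e1]), w) (T2 (?M N))
         (0, stack (st @ [aval x st e1, aval x st e2]), w)"
      using ev(3) by (simp_all add: aval_snoc)
    have 3: "g (aval x st e1) (aval x st e2) \<le> T (?L N) \<and>
       runs x P (0, stack (st @ [aval x st e1, aval x st e2]), w) (T (?L N))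
        (0, stack (st @ [g (aval x st e1) (aval x st e2)]), w)"
      using 1(1) 2(1) by (intro op st) auto
    show "aval x st e \<le> ?T N \<and> runs x (P1 @ P2 @ P) (0, stack st, w) (?T N)
        (0, stack (st @ [aval x st e]), w)"
      using 3 runs_append[OF 1(2) runs_append[OF 2(2) conjunct2[OF 3]]] by (simp add: e add.assoc)
  qed
  moreover have M: "poly_bounded ?M" using pb by (intro poly_bounded_intros)
  have L: "poly_bounded ?L"
    using pb poly_bounded_compose[OF pb(2) M] by (intro poly_bounded_intros)
  have "poly_bounded ?T"
    using pb poly_bounded_compose[OF pb(2) M] poly_bounded_compose[OF pb(3) L]
    by (intro poly_bounded_intros)
  ultimately show ?thesis by blast
qed

text \<open>Values stay polynomial in the bound on the input length and the variables, so unary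
  arithmetic on counters is fast enough.\<close>

lemma exists_evaluates: "scoped d e \<Longrightarrow> \<exists>P T. poly_bounded T \<and> evaluates P T d e"
proof (induction e arbitrary: d)
  case (Const k)
  have "runs x (replicate k (Inc d)) (0, stack st, w) k (0, stack (st @ [k]), w)"
    if "length st = d" for x st w
  proof (induction k)
    case 0
    then show ?case by (simp add: runs_Nil stack_pop)
  next
    case (Suc k)
    have "(stack (st @ [k]))(d := Suc (stack (st @ [k]) d)) = stack (st @ [Suc k])"
      using that by (auto simp: stack_upd_last stack_top)
    then show ?case
      using runs_append[OF Suc runs_Inc[of x d 0 "stack (st @ [k])" w]]
      by (simp add: replicate_append_same)
  qed
  then have "evaluates (replicate k (Inc d)) (\<lambda>N. k) d (Const k)"
    by (simp add: evaluates_def)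
  then show ?case using poly_bounded_const by blast
next
  case (Var i)
  have "runs x (add_reg i d (Suc d)) (0, stack st, w) (9 * N + 2) (0, stack (st @ [st ! i]), w)"
    if "length st = d" "bounded_by N x st" for x st N w
  proof -
    have "stack st i = st ! i" "st ! i \<le> N"
      using that Var nth_mem[of i st] by (auto simp: stack_def bounded_by_def)
    moreover have "(stack st)(d := st ! i) = stack (st @ [st ! i])"
      using that stack_upd_top by blast
    ultimately show ?thesis
      using runs_add_reg[of i d "Suc d" "stack st" x 0 w] Var that
      by (intro runs_mono[OF _ add_right_mono[OF mult_left_mono[of "st ! i" N 9]]])
        (auto simp: stack_top)
  qed
  moreover have "st ! i \<le> 9 * N + 2" if "length st = d" "bounded_by N x st" for x st N
  proof -
    have "st ! i \<le> N" using that Var nth_mem[of i st] by (auto simp: bounded_by_def)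
    then show ?thesis by simp
  qed
  ultimately have "evaluates (add_reg i d (Suc d)) (\<lambda>N. 9 * N + 2) d (Var i)"
    by (simp add: evaluates_def)
  then show ?case by (blast intro: poly_bounded_intros)
next
  case Len
  \<comment> \<open>The first blank is in cell \<open>length x\<close>. Register
    \<open>Suc d\<close> counts along with \<open>d\<close> and is used up to bring the head
    back.\<close>
  let ?P = "until (Symbol 0) [InR, Inc d, Inc (Suc d)] @ until (Zero (Suc d)) [Dec (Suc d), InL]"
  have "runs x ?P (0, stack st, w) (9 * N + 2) (0, stack (st @ [length x]), w)"
    if "length st = d" "bounded_by N x st" for x st N w
  proof -
    let ?n = "length x"
    let ?S = "\<lambda>i. (?n - i, (stack st)(d := ?n - i, Suc d := ?n - i), w)"
    have "runs x [InR, Inc d, Inc (Suc d)] (?S (Suc i)) 3 (?S i)" if "i < ?n" for i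
      by (rule runs_straight) (use that in \<open>auto simp: fun_eq_iff\<close>)
    then have 1: "runs x (until (Symbol 0) [InR, Inc d, Inc (Suc d)]) (?S ?n) (?n * (3 + 2) + 1) (?S 0)"
      by (intro runs_until[where S = "?S"]) (auto simp: tape_of_def)
    let ?S' = "\<lambda>i. (i, (stack st)(d := ?n, Suc d := i), w)"
    have "runs x [Dec (Suc d), InL] (?S' (Suc i)) 2 (?S' i)" for i
      by (rule runs_straight) (auto simp: fun_eq_iff)
    then have 2: "runs x (until (Zero (Suc d)) [Dec (Suc d), InL]) (?S' ?n) (?n * (2 + 2) + 1) (?S' 0)"
      by (intro runs_until[where S = "?S'"]) auto
    have "?S ?n = (0, stack st, w)" "?S' 0 = (0, stack (st @ [?n]), w)"
      using that by (auto simp: fun_eq_iff stack_def nth_append)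
    moreover have "runs x ?P (?S ?n) (?n * (3 + 2) + 1 + (?n * (2 + 2) + 1)) (?S' 0)"
      by (rule runs_append[OF 1]) (use 2 in simp)
    ultimately have "runs x ?P (0, stack st, w) (9 * ?n + 2) (0, stack (st @ [?n]), w)"
      by (simp add: algebra_simps)
    then show ?thesis
      by (rule runs_mono) (use that in \<open>simp add: bounded_by_def\<close>)
  qed
  then have "evaluates ?P (\<lambda>N. 9 * N + 2) d Len"
    by (auto simp: evaluates_def bounded_by_def)
  then show ?case by (blast intro: poly_bounded_intros)
next
  case (Input e)
  then obtain P T where P: "evaluates P T d e" and T: "poly_bounded T" by (meson scoped.simps(4))
  let ?P1 = "until (Zero d) [Dec d, InR, Inc (Suc d)]"
  \<comment> \<open>Register \<open>d\<close> has been counted down to 0; the symbol is 0, 1 or 2,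
    so at most two conditional increments copy it there.\<close>
  let ?P2 = "unless (Symbol 0) (Inc d # unless (Symbol 1) [Inc d])"
  let ?P3 = "until (Zero (Suc d)) [Dec (Suc d), InL]"
  let ?T = "\<lambda>N. T N + 9 * T N + 10"
  have "runs x (P @ ?P1 @ ?P2 @ ?P3) (0, stack st, w) (?T N)
      (0, stack (st @ [tape_of x (aval x st e)]), w)" if st: "length st = d" "bounded_by N x st" for x st N w
  proof -
    let ?v = "aval x st e"
    note ev = evaluatesD[OF P st]
    let ?S = "\<lambda>i. (?v - i, (stack st)(d := i, Suc d := ?v - i), w)"
    have "runs x [Dec d, InR, Inc (Suc d)] (?S (Suc i)) 3 (?S i)" if "i < ?v" for i
      by (rule runs_straight) (use that in \<open>auto simp: fun_eq_iff\<close>)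
    then have 1: "runs x ?P1 (?S ?v) (?v * (3 + 2) + 1) (?S 0)"
      by (intro runs_until[where S = "?S"]) auto
    let ?S' = "\<lambda>i. (i, (stack st)(d := tape_of x ?v, Suc d := i), w)"
    have "tape_of x ?v = 0 \<or> tape_of x ?v = 1 \<or> tape_of x ?v = 2" by (simp add: tape_of_def)
    then have 2: "runs x ?P2 (?S 0) 4 (?S' ?v)"
    proof (elim disjE)
      assume "tape_of x ?v = 0"
      then have s: "?S 0 = ?S' ?v" and "holds x (Symbol 0) (?S 0)" by auto
      from this(2) have "runs x ?P2 (?S 0) 1 (?S 0)" by (rule runs_unless_skip)
      then have "runs x ?P2 (?S 0) 4 (?S 0)" by (rule runs_mono) simp
      from back_subst[of "runs x ?P2 (?S 0) 4", OF this s] show ?thesis .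
    next
      assume 1: "tape_of x ?v = 1"
      let ?s = "effect x (Inc d) (?S 0)"
      have s: "?s = ?S' ?v" using 1 by (auto simp: fun_eq_iff)
      have "runs x (unless (Symbol 1) [Inc d]) ?s 1 ?s"
        using 1 by (intro runs_unless_skip) auto
      then have "runs x (Inc d # unless (Symbol 1) [Inc d]) (?S 0) (Suc 1) ?s"
        by (intro runs_straight_Cons) auto
      then have "runs x ?P2 (?S 0) (Suc (Suc 1)) ?s"
        using 1 by (intro runs_unless) auto
      then show ?thesis unfolding s by (rule runs_mono) simp
    next
      assume 2: "tape_of x ?v = 2"
      let ?s = "effect x (Inc d) (?S 0)"
      have s: "effect x (Inc d) ?s = ?S' ?v" using 2 by (auto simp: fun_eq_iff)
      have "runs x (unless (Symbol 1) [Inc d]) ?s (Suc 1) (effect x (Inc d) ?s)"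
        using 2 by (intro runs_unless runs_straight_instr) auto
      then have "runs x (Inc d # unless (Symbol 1) [Inc d]) (?S 0) (Suc (Suc 1)) (effect x (Inc d) ?s)"
        by (intro runs_straight_Cons) auto
      then have "runs x ?P2 (?S 0) (Suc (Suc (Suc 1))) (effect x (Inc d) ?s)"
        using 2 by (intro runs_unless) auto
      then show ?thesis unfolding s by (rule runs_mono) simp
    qed
    have "runs x [Dec (Suc d), InL] (?S' (Suc i)) 2 (?S' i)" for i
      by (rule runs_straight) (auto simp: fun_eq_iff)
    then have 3: "runs x ?P3 (?S' ?v) (?v * (2 + 2) + 1) (?S' 0)"
      by (intro runs_until[where S = "?S'"]) auto
    have eq: "?S ?v = (0, stack (st @ [?v]), w)" "?S' 0 = (0, stack (st @ [tape_of x ?v]), w)"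
      using st by (auto simp: fun_eq_iff stack_def nth_append)
    from runs_append[OF ev(2) runs_append[OF 1[unfolded eq] runs_append[OF 2 3[unfolded eq]]]]
    show ?thesis by (rule runs_mono) (use ev(1) in auto)
  qed
  moreover have "tape_of x v \<le> ?T N" for x v N by (simp add: tape_of_def)
  ultimately have "evaluates (P @ ?P1 @ ?P2 @ ?P3) ?T d (Input e)"
    by (simp add: evaluates_def)
  moreover have "poly_bounded ?T" using T by (intro poly_bounded_intros)
  ultimately show ?case by blast
next
  case (Add e1 e2)
  then obtain P1 T1 P2 T2 where P: "evaluates P1 T1 d e1" "evaluates P2 T2 (Suc d) e2"
    "poly_bounded T1" "poly_bounded T2" by (metis scoped.simps(5) scoped_Suc)
  have op: "a + b \<le> 4 * N + 1 \<and> runs x (move_reg (Suc d) d) (0, stack (st @ [a, b]), w) (4 * N + 1)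
      (0, stack (st @ [a + b]), w)" if "length st = d" "a \<le> N" "b \<le> N" for x st a b N w
  proof -
    let ?R = "stack (st @ [a, b])"
    have "?R(d := ?R d + ?R (Suc d), Suc d := 0) = stack (st @ [a + b])"
      using that by (auto simp: stack_def fun_eq_iff nth_append)
    then have "runs x (move_reg (Suc d) d) (0, ?R, w) (4 * b + 1) (0, stack (st @ [a + b]), w)"
      using runs_move_reg[of "Suc d" d x 0 ?R w] that by (auto simp: stack_top)
    then show ?thesis using that by (auto elim: runs_mono)
  qed
  have T: "poly_bounded (\<lambda>N. 4 * N + 1)" by (intro poly_bounded_intros)
  show ?case
    by (rule evaluates_binop[OF P(1,2) _ P(3,4) T op]) (use Add.prems in auto)
next
  case (Sub e1 e2)
  then obtain P1 T1 P2 T2 where P: "evaluates P1 T1 d e1" "evaluates P2 T2 (Suc d) e2"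
    "poly_bounded T1" "poly_bounded T2" by (metis scoped.simps(6) scoped_Suc)
  have op: "a - b \<le> 4 * N + 1 \<and> runs x (sub_reg (Suc d) d) (0, stack (st @ [a, b]), w) (4 * N + 1)
      (0, stack (st @ [a - b]), w)" if "length st = d" "a \<le> N" "b \<le> N" for x st a b N w
  proof -
    let ?R = "stack (st @ [a, b])"
    have "?R(d := ?R d - ?R (Suc d), Suc d := 0) = stack (st @ [a - b])"
      using that by (auto simp: stack_def fun_eq_iff nth_append)
    then have "runs x (sub_reg (Suc d) d) (0, ?R, w) (4 * b + 1) (0, stack (st @ [a - b]), w)"
      using runs_sub_reg[of "Suc d" d x 0 ?R w] that by (auto simp: stack_top)
    then show ?thesis using that by (auto elim: runs_mono)
  qed
  have T: "poly_bounded (\<lambda>N. 4 * N + 1)" by (intro poly_bounded_intros)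
  show ?case
    by (rule evaluates_binop[OF P(1,2) _ P(3,4) T op]) (use Sub.prems in auto)
next
  case (Mul e1 e2)
  then obtain P1 T1 P2 T2 where P: "evaluates P1 T1 d e1" "evaluates P2 T2 (Suc d) e2"
    "poly_bounded T1" "poly_bounded T2" by (metis scoped.simps(7) scoped_Suc)
  let ?d1 = "Suc d" and ?d2 = "Suc (Suc d)" and ?d3 = "Suc (Suc (Suc d))"
  \<comment> \<open>Repeated addition: \<open>?d1\<close> keeps the second factor,
    \<open>?d2\<close> accumulates the product and \<open>?d3\<close> is scratch.\<close>
  let ?Q1 = "until (Zero d) (Dec d # add_reg ?d1 ?d2 ?d3)"
  let ?Q = "?Q1 @ clear ?d1 @ move_reg ?d2 d"
  let ?T = "\<lambda>N. N * (9 * N + 5) + 1 + (3 * N + 1) + (4 * (N * N) + 1)"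
  have op: "a * b \<le> ?T N \<and> runs x ?Q (0, stack (st @ [a, b]), w) (?T N)
      (0, stack (st @ [a * b]), w)" if st: "length st = d" "a \<le> N" "b \<le> N" for x st a b N w
  proof -
    have ab: "a * b \<le> N * N" using that by (intro mult_mono) auto
    let ?R = "stack (st @ [a, b])"
    let ?S = "\<lambda>i. (0, ?R(d := i, ?d2 := (a - i) * b), w)"
    have step: "runs x (Dec d # add_reg ?d1 ?d2 ?d3) (?S (Suc i)) (Suc (9 * b + 2)) (?S i)" if "i < a" for i
    proof -
      let ?R1 = "?R(d := i, ?d2 := (a - Suc i) * b)"
      have "effect x (Dec d) (?S (Suc i)) = (0, ?R1, w)"
        by (auto simp: fun_eq_iff)
      moreover have "a - i = Suc (a - Suc i)" using that by simp
      then have "?R1(?d2 := ?R1 ?d2 + ?R1 ?d1) = ?R(d := i, ?d2 := (a - i) * b)"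
        using st by (auto simp: fun_eq_iff stack_top)
      moreover have "?R1 ?d3 = 0" "?R1 ?d1 = b" using st by (auto simp: stack_top)
      ultimately show ?thesis
        using runs_add_reg[of ?d1 ?d2 ?d3 ?R1 x 0 w] by (intro runs_straight_Cons) auto
    qed
    have 1: "runs x ?Q1 (?S a) (a * (Suc (9 * b + 2) + 2) + 1) (?S 0)"
      using step by (intro runs_until[where S = "?S"]) auto
    let ?R2 = "?R(d := 0, ?d2 := a * b)" and ?R3 = "?R(d := 0, ?d1 := 0, ?d2 := a * b)"
    have 2: "runs x (clear ?d1) (0, ?R2, w) (3 * b + 1) (0, ?R3, w)"
      using runs_clear[of x ?d1 0 ?R2 w] st by (auto simp: stack_top fun_upd_twist)
    have 3: "runs x (move_reg ?d2 d) (0, ?R3, w) (4 * (a * b) + 1) (0, stack (st @ [a * b]), w)"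
    proof -
      have "?R3(d := ?R3 d + ?R3 ?d2, ?d2 := 0) = stack (st @ [a * b])"
        using st by (auto simp: stack_def fun_eq_iff nth_append)
      then show ?thesis using runs_move_reg[of ?d2 d x 0 ?R3 w] by auto
    qed
    have "?S a = (0, ?R, w)" using st by (auto simp: stack_def fun_eq_iff nth_append)
    moreover have "?S 0 = (0, ?R2, w)" by simp
    ultimately have 1: "runs x ?Q1 (0, ?R, w) (a * (9 * b + 5) + 1) (0, ?R2, w)"
      using 1 by (simp add: algebra_simps)
    have "runs x ?Q (0, ?R, w) (a * (9 * b + 5) + 1 + (3 * b + 1 + (4 * (a * b) + 1)))
        (0, stack (st @ [a * b]), w)"
      by (rule runs_append[OF 1 runs_append[OF 2 3]])
    moreover have "a * (9 * b + 5) \<le> N * (9 * N + 5)" using that by (intro mult_mono) auto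
    ultimately have "runs x ?Q (0, ?R, w) (?T N) (0, stack (st @ [a * b]), w)"
      using that ab by (elim runs_mono) linarith
    then show ?thesis using ab by auto
  qed
  have T: "poly_bounded (\<lambda>N. N * (9 * N + 5) + 1 + (3 * N + 1) + (4 * (N * N) + 1))" by (intro poly_bounded_intros)
  show ?case
    by (rule evaluates_binop[OF P(1,2) _ P(3,4) T op]) (use Mul.prems in auto)
qed

section \<open>Binary output of a unary counter\<close>

definition halve :: "nat \<Rightarrow> instr list" where
  "halve d = until (Zero d) (Dec d # if_then_else (Zero (Suc (Suc d)))
     [Inc (Suc (Suc d))] [Dec (Suc (Suc d)), Inc (Suc d)])"

text \<open>Register \<open>Suc (Suc d)\<close> holds the parity of the number of decrements; every
  second decrement resets it and increases the quotient in \<open>Suc d\<close>.\<close>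

lemma runs_halve:
  assumes "R (Suc d) = 0" "R (Suc (Suc d)) = 0"
  shows "runs x (halve d) (h, R, w) (7 * R d + 1)
    (h, R(d := 0, Suc d := R d div 2, Suc (Suc d) := R d mod 2), w)"
proof -
  let ?v = "R d"
  let ?S = "\<lambda>i. (h, R(d := i, Suc d := (?v - i) div 2, Suc (Suc d) := (?v - i) mod 2), w)"
  have step: "runs x (Dec d # if_then_else (Zero (Suc (Suc d)))
     [Inc (Suc (Suc d))] [Dec (Suc (Suc d)), Inc (Suc d)]) (?S (Suc i)) 5 (?S i)" if i: "i < ?v" for i
  proof -
    let ?s = "effect x (Dec d) (?S (Suc i))"
    have v: "?v - i = Suc (?v - Suc i)" using i by simp
    have "runs x (if_then_else (Zero (Suc (Suc d)))
       [Inc (Suc (Suc d))] [Dec (Suc (Suc d)), Inc (Suc d)]) ?s 4 (?S i)"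
    proof (cases "even (?v - Suc i)")
      case True
      then have "effect x (Inc (Suc (Suc d))) ?s = ?S i"
        unfolding v by (auto simp: fun_eq_iff even_iff_mod_2_eq_zero mod_Suc)
      then have "runs x [Inc (Suc (Suc d))] ?s 1 (?S i)"
        using runs_straight_instr[of "Inc (Suc (Suc d))" x ?s] by simp
      then have "runs x (if_then_else (Zero (Suc (Suc d)))
         [Inc (Suc (Suc d))] [Dec (Suc (Suc d)), Inc (Suc d)]) ?s (1 + 1) (?S i)"
        using True by (intro runs_if_true) (auto simp: even_iff_mod_2_eq_zero)
      then show ?thesis by (rule runs_mono) simp
    next
      case False
      then have eq: "fold (effect x) [Dec (Suc (Suc d)), Inc (Suc d)] ?s = ?S i"
        unfolding v by (auto simp: fun_eq_iff odd_iff_mod_2_eq_one mod_Suc)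
      have "runs x [Dec (Suc (Suc d)), Inc (Suc d)] ?s 2 (?S i)"
        by (rule runs_straight[OF _ eq]) auto
      then have "runs x (if_then_else (Zero (Suc (Suc d)))
         [Inc (Suc (Suc d))] [Dec (Suc (Suc d)), Inc (Suc d)]) ?s (2 + 2) (?S i)"
        using False by (intro runs_if_false) (auto simp: odd_iff_mod_2_eq_one simp del: even_diff_nat)
      then show ?thesis by simp
    qed
    then have "runs x (Dec d # if_then_else (Zero (Suc (Suc d)))
       [Inc (Suc (Suc d))] [Dec (Suc (Suc d)), Inc (Suc d)]) (?S (Suc i)) (Suc 4) (?S i)"
      by (intro runs_straight_Cons) auto
    then show ?thesis by simp
  qed
  have "?S ?v = (h, R, w)" using assms by (auto simp: fun_eq_iff)
  moreover have "runs x (halve d) (?S ?v) (?v * (5 + 2) + 1) (?S 0)"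
    unfolding halve_def using step by (intro runs_until[where S = "?S"]) auto
  ultimately show ?thesis by (simp add: mult.commute)
qed

text \<open>The leading \<open>True\<close> is the continuation bit of \<open>enc_nat\<close>.
  Printing the remainder also clears it, and the quotient returns to \<open>d\<close>.\<close>

definition out_digit :: "nat \<Rightarrow> instr list" where
  "out_digit d = Out True # halve d @ if_then_else (Zero (Suc (Suc d)))
     [Out False] [Out True, Dec (Suc (Suc d))] @ move_reg (Suc d) d"

lemma runs_out_digit:
  assumes "R (Suc d) = 0" "R (Suc (Suc d)) = 0"
  shows "runs x (out_digit d) (h, R, w) (11 * R d + 7) (h, R(d := R d div 2), w @ [True, odd (R d)])"
proof -
  let ?w = "w @ [True]"
  let ?I = "if_then_else (Zero (Suc (Suc d))) [Out False] [Out True, Dec (Suc (Suc d))]"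
  let ?R1 = "R(d := 0, Suc d := R d div 2, Suc (Suc d) := R d mod 2)"
  let ?R2 = "R(d := 0, Suc d := R d div 2)"
  have 1: "runs x (halve d) (h, R, ?w) (7 * R d + 1) (h, ?R1, ?w)"
    by (rule runs_halve[OF assms])
  have 2: "runs x ?I (h, ?R1, ?w) 4 (h, ?R2, ?w @ [odd (R d)])"
  proof (cases "even (R d)")
    case True
    then have "effect x (Out False) (h, ?R1, ?w) = (h, ?R2, ?w @ [odd (R d)])"
      using assms by (auto simp: fun_eq_iff even_iff_mod_2_eq_zero)
    then have "runs x ?I (h, ?R1, ?w) (1 + 1) (h, ?R2, ?w @ [odd (R d)])"
      using True runs_straight_instr[of "Out False" x "(h, ?R1, ?w)"]
      by (intro runs_if_true) (auto simp: even_iff_mod_2_eq_zero)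
    then show ?thesis by (rule runs_mono) simp
  next
    case False
    then have eq: "fold (effect x) [Out True, Dec (Suc (Suc d))] (h, ?R1, ?w) = (h, ?R2, ?w @ [odd (R d)])"
      using assms by (auto simp: fun_eq_iff odd_iff_mod_2_eq_one)
    have "runs x [Out True, Dec (Suc (Suc d))] (h, ?R1, ?w) 2 (h, ?R2, ?w @ [odd (R d)])"
      by (rule runs_straight[OF _ eq]) auto
    then have "runs x ?I (h, ?R1, ?w) (2 + 2) (h, ?R2, ?w @ [odd (R d)])"
      using False by (intro runs_if_false) (auto simp: odd_iff_mod_2_eq_one)
    then show ?thesis by simp
  qed
  have 3: "runs x (move_reg (Suc d) d) (h, ?R2, ?w @ [odd (R d)]) (4 * (R d div 2) + 1)
      (h, R(d := R d div 2), ?w @ [odd (R d)])"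
  proof -
    have "?R2(d := ?R2 d + ?R2 (Suc d), Suc d := 0) = R(d := R d div 2)"
      using assms by (auto simp: fun_eq_iff)
    then show ?thesis using runs_move_reg[of "Suc d" d x h ?R2 "?w @ [odd (R d)]"] by auto
  qed
  have "runs x (out_digit d) (h, R, w) (Suc (7 * R d + 1 + (4 + (4 * (R d div 2) + 1))))
      (h, R(d := R d div 2), ?w @ [odd (R d)])"
    unfolding out_digit_def using runs_append[OF 1 runs_append[OF 2 3]]
    by (intro runs_straight_Cons) auto
  then have "runs x (out_digit d) (h, R, w) (Suc (7 * R d + 1 + (4 + (4 * (R d div 2) + 1))))
      (h, R(d := R d div 2), w @ [True, odd (R d)])" by simp
  then show ?thesis by (rule runs_mono) simp
qed

definition out_nat :: "nat \<Rightarrow> instr list" where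
  "out_nat d = until (Zero d) (out_digit d) @ [Out False]"

text \<open>\<open>enc_nat\<close> recurses by halving, so the loop produces its digits in the right
  order; the final \<open>False\<close> is split off for the induction.\<close>

lemma runs_out_nat:
  assumes "R (Suc d) = 0" "R (Suc (Suc d)) = 0"
  shows "runs x (out_nat d) (h, R, w) (R d * (11 * R d + 9) + 2) (h, R(d := 0), w @ enc_nat (R d))"
proof -
  have "\<exists>u. enc_nat (R d) = u @ [False] \<and>
    runs x (until (Zero d) (out_digit d)) (h, R, w) (R d * (11 * R d + 9) + 1) (h, R(d := 0), w @ u)"
    using assms
  proof (induction "R d" arbitrary: R w rule: less_induct)
    case less
    show ?case
    proof (cases "R d = 0")
      case True
      then have "R(d := 0) = R" by auto
      then show ?thesis
        using True runs_until_stop[of x "Zero d" "(h, R, w)" "out_digit d"]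
        by (simp add: enc_nat.simps[of 0])
    next
      case False
      let ?v = "R d" and ?R = "R(d := R d div 2)"
      have "?R d < ?v" using False by simp
      with less.hyps[of ?R "w @ [True, odd ?v]"] less.prems obtain u where
        u: "enc_nat (?v div 2) = u @ [False]"
        "runs x (until (Zero d) (out_digit d)) (h, ?R, w @ [True, odd ?v])
           (?v div 2 * (11 * (?v div 2) + 9) + 1) (h, R(d := 0), w @ [True, odd ?v] @ u)" by auto
      have "runs x (until (Zero d) (out_digit d)) (h, R, w)
         (11 * ?v + 7 + (?v div 2 * (11 * (?v div 2) + 9) + 1) + 2) (h, R(d := 0), w @ [True, odd ?v] @ u)"
        using False by (intro runs_until_step[OF _ runs_out_digit[of R d, OF less.prems] u(2)]) auto
      \<comment> \<open>Since \<open>?v div 2 \<le> ?v - 1\<close>, one summand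
        \<open>11 * ?v + 9\<close> remains to pay for the current digit.\<close>
      moreover have "?v div 2 * (11 * (?v div 2) + 9) \<le> (?v - 1) * (11 * ?v + 9)"
        using False by (intro mult_mono) auto
      then have "11 * ?v + 7 + (?v div 2 * (11 * (?v div 2) + 9) + 1) + 2 \<le> ?v * (11 * ?v + 9) + 1"
        using False by (cases ?v) auto
      ultimately have "runs x (until (Zero d) (out_digit d)) (h, R, w) (?v * (11 * ?v + 9) + 1)
          (h, R(d := 0), w @ [True, odd ?v] @ u)" by (rule runs_mono)
      moreover have "enc_nat ?v = ([True, odd ?v] @ u) @ [False]"
        using False u(1) by (simp add: enc_nat.simps[of ?v])
      ultimately show ?thesis by blast
    qed
  qed
  then obtain u where u: "enc_nat (R d) = u @ [False]"
    "runs x (until (Zero d) (out_digit d)) (h, R, w) (R d * (11 * R d + 9) + 1) (h, R(d := 0), w @ u)"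
    by blast
  from runs_append[OF u(2) runs_Out[of x False]] show ?thesis
    by (simp add: out_nat_def u(1))
qed

text \<open>The stack acts as the environment of loop variables and is handed back unchanged, so
  printing code can be sequenced and iterated.\<close>

definition prints :: "instr list \<Rightarrow> (nat \<Rightarrow> nat) \<Rightarrow> nat \<Rightarrow> (bool list \<Rightarrow> nat list \<Rightarrow> bool list) \<Rightarrow> bool" where
  "prints P T d f \<longleftrightarrow> (\<forall>x st N w. length st = d \<longrightarrow> bounded_by N x st \<longrightarrow>
     runs x P (0, stack st, w) (T N) (0, stack st, w @ f x st))"

definition poly_printable :: "nat \<Rightarrow> (bool list \<Rightarrow> nat list \<Rightarrow> bool list) \<Rightarrow> bool" where
  "poly_printable d f \<longleftrightarrow> (\<exists>P T. poly_bounded T \<and> prints P T d f)"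

lemma poly_printable_append:
  assumes "poly_printable d f" "poly_printable d g"
  shows "poly_printable d (\<lambda>x st. f x st @ g x st)"
proof -
  obtain P T P' T' where P: "poly_bounded T" "prints P T d f" "poly_bounded T'" "prints P' T' d g"
    using assms unfolding poly_printable_def by blast
  have "prints (P @ P') (\<lambda>N. T N + T' N) d (\<lambda>x st. f x st @ g x st)"
    unfolding prints_def
  proof (intro allI impI)
    fix x st N w assume st: "length st = d" "bounded_by N x st"
    have "runs x P (0, stack st, w) (T N) (0, stack st, w @ f x st)"
      "runs x P' (0, stack st, w @ f x st) (T' N) (0, stack st, (w @ f x st) @ g x st)"
      using P st unfolding prints_def by blast+
    from runs_append[OF this] show "runs x (P @ P') (0, stack st, w) (T N + T' N)
       (0, stack st, w @ f x st @ g x st)" by simp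
  qed
  then show ?thesis using P unfolding poly_printable_def by (blast intro: poly_bounded_intros)
qed

lemma poly_printable_Nil: "poly_printable d (\<lambda>x st. [])"
proof -
  have "prints [] (\<lambda>N. 0) d (\<lambda>x st. [])" by (simp add: prints_def runs_Nil)
  then show ?thesis unfolding poly_printable_def by (blast intro: poly_bounded_intros)
qed

lemma poly_printable_bit: "poly_printable d (\<lambda>x st. [b])"
proof -
  have "prints [Out b] (\<lambda>N. 1) d (\<lambda>x st. [b])"
    using runs_Out by (simp add: prints_def)
  then show ?thesis unfolding poly_printable_def by (blast intro: poly_bounded_intros)
qed

lemma poly_printable_enc_nat:
  assumes "scoped d e"
  shows "poly_printable d (\<lambda>x st. enc_nat (aval x st e))"
proof -
  obtain P T where P: "poly_bounded T" "evaluates P T d e" using exists_evaluates[OF assms] by blast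
  let ?T = "\<lambda>N. T N + (T N * (11 * T N + 9) + 2)"
  have "prints (P @ out_nat d) ?T d (\<lambda>x st. enc_nat (aval x st e))"
    unfolding prints_def
  proof (intro allI impI)
    fix x st N w assume st: "length st = d" "bounded_by N x st"
    note ev = evaluatesD[OF P(2) st]
    let ?v = "aval x st e" and ?R = "stack (st @ [aval x st e])"
    have "?R(d := 0) = stack st" "?R d = ?v" "?R (Suc d) = 0" "?R (Suc (Suc d)) = 0"
      using st by (auto simp: stack_upd_last stack_pop stack_top)
    then have "runs x (out_nat d) (0, ?R, w) (?v * (11 * ?v + 9) + 2) (0, stack st, w @ enc_nat ?v)"
      using runs_out_nat[of ?R d x 0 w] by simp
    from runs_append[OF ev(2) this] show "runs x (P @ out_nat d) (0, stack st, w) (?T N)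
       (0, stack st, w @ enc_nat ?v)"
      by (rule runs_mono) (use ev(1) in \<open>auto intro!: add_mono mult_mono\<close>)
  qed
  moreover have "poly_bounded ?T" using P by (intro poly_bounded_intros)
  ultimately show ?thesis unfolding poly_printable_def by blast
qed

lemma poly_printable_for:
  assumes "scoped d e" "poly_printable (Suc d) f"
  shows "poly_printable d (\<lambda>x st. concat (map (\<lambda>i. f x (st @ [i])) (rev [0..<aval x st e])))"
proof -
  obtain P T where P: "poly_bounded T" "evaluates P T d e" using exists_evaluates[OF assms(1)] by blast
  obtain P' T' where P': "poly_bounded T'" "prints P' T' (Suc d) f"
    using assms(2) unfolding poly_printable_def by blast
  \<comment> \<open>The output produced once the counter has come down to \<open>i\<close>.\<close>
  let ?out = "\<lambda>x st i. concat (map (\<lambda>i. f x (st @ [i])) (rev [i..<aval x st e]))"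
  let ?T = "\<lambda>N. T N + (T N * (Suc (T' (N + T N)) + 2) + 1)"
  have "prints (P @ until (Zero d) (Dec d # P')) ?T d (\<lambda>x st. ?out x st 0)"
    unfolding prints_def
  proof (intro allI impI)
    fix x st N w assume st: "length st = d" "bounded_by N x st"
    note ev = evaluatesD[OF P(2) st]
    let ?v = "aval x st e" and ?t = "Suc (T' (N + T N))"
    let ?S = "\<lambda>i. (0, stack (st @ [i]), w @ ?out x st i)"
    have "runs x (Dec d # P') (?S (Suc i)) ?t (?S i)" if "i < ?v" for i
    proof (rule runs_straight_Cons)
      have "effect x (Dec d) (?S (Suc i)) = (0, stack (st @ [i]), w @ ?out x st (Suc i))"
        using st by (auto simp: stack_top stack_upd_last)
      moreover have "bounded_by (N + T N) x (st @ [i])"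
        using bounded_by_snoc[OF st(2), of i "T N"] that ev(1) by simp
      then have "runs x P' (0, stack (st @ [i]), w) (T' (N + T N))
          (0, stack (st @ [i]), w @ f x (st @ [i]))" for w
        using P'(2) st unfolding prints_def by simp
      note this[of "w @ ?out x st (Suc i)"]
      moreover have "?out x st (Suc i) @ f x (st @ [i]) = ?out x st i"
        using that by (simp add: upt_conv_Cons)
      ultimately show "runs x P' (effect x (Dec d) (?S (Suc i))) (T' (N + T N)) (?S i)"
        by simp
    qed simp
    then have "runs x (until (Zero d) (Dec d # P')) (?S ?v) (?v * (?t + 2) + 1) (?S 0)"
      using st by (intro runs_until[where S = "?S"]) (auto simp: stack_top)
    then have "runs x (until (Zero d) (Dec d # P')) (0, stack (st @ [?v]), w) (?v * (?t + 2) + 1)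
        (0, stack st, w @ ?out x st 0)" by (simp add: stack_pop)
    from runs_append[OF ev(2) this]
    show "runs x (P @ until (Zero d) (Dec d # P')) (0, stack st, w) (?T N) (0, stack st, w @ ?out x st 0)"
      by (rule runs_mono) (use ev(1) in \<open>auto intro!: add_mono mult_mono\<close>)
  qed
  moreover have M: "poly_bounded (\<lambda>N. N + T N)" using P by (intro poly_bounded_intros)
  have "poly_bounded ?T"
    unfolding Suc_eq_plus1 using P poly_bounded_compose[OF P'(1) M] by (intro poly_bounded_intros)
  ultimately show ?thesis unfolding poly_printable_def by blast
qed

lemma polytime_computable_if_printable:
  assumes "poly_printable 0 f"
  shows "polytime_computable (\<lambda>x. f x [])"
proof -
  obtain P T where P: "poly_bounded T" "prints P T 0 f"
    using assms unfolding poly_printable_def by blast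
  obtain k where k: "\<And>N. T N \<le> (N + 2) ^ k" using P(1) unfolding poly_bounded_def by blast
  have "finite (\<Union>i\<in>set P. regs i)"
  proof -
    have "finite (regs i)" for i by (cases i rule: regs.cases) auto
    then show ?thesis by simp
  qed
  then obtain K where "\<forall>r\<in>(\<Union>i\<in>set P. regs i). r < K"
    using finite_nat_set_iff_bounded by blast
  then have K: "\<forall>i\<in>set P. \<forall>r\<in>regs i. r < K" by blast
  have "stack [] = (\<lambda>_. 0)" by (simp add: stack_def fun_eq_iff)
  then have "runs x P (0, \<lambda>_. 0, []) (T (length x)) (0, \<lambda>_. 0, f x [])" for x
    using P(2)[unfolded prints_def, rule_format, of "[]" "length x" x "[]"]
    by (simp add: bounded_by_def)
  then have "computes_in_time (machine K P) (\<lambda>x. f x []) (\<lambda>n. Suc (T n))"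
    by (intro runs_imp_computes[OF K]) blast
  \<comment> \<open>\<open>[:2, 1:]\<close> is the polynomial \<open>n + 2\<close>; the added 1 is
    the initial step of the machine.\<close>
  moreover have "Suc (T n) \<le> poly ([:2, 1:] ^ k + 1) n" for n
    using k[of n] by (simp add: add.commute)
  ultimately have "computes_in_time (machine K P) (\<lambda>x. f x []) (poly ([:2, 1:] ^ k + 1))"
    unfolding computes_in_time_def by (meson le_trans)
  then show ?thesis using wf_machine[OF K] unfolding polytime_computable_def by blast
qed

section \<open>A loop language for lists of generators\<close>

datatype prog = Gen aexp aexp aexp | Seq prog prog | Skip | For aexp prog

text \<open>The loop variable is the loop counter itself, hence the descending order.\<close>

fun triples :: "bool list \<Rightarrow> nat list \<Rightarrow> prog \<Rightarrow> triple list" where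
  "triples x env (Gen e1 e2 e3) = [(aval x env e1, aval x env e2, aval x env e3)]"
| "triples x env (Seq c1 c2) = triples x env c1 @ triples x env c2"
| "triples x env Skip = []"
| "triples x env (For e c) = concat (map (\<lambda>i. triples x (env @ [i]) c) (rev [0..<aval x env e]))"

fun prog_scoped :: "nat \<Rightarrow> prog \<Rightarrow> bool" where
  "prog_scoped d (Gen e1 e2 e3) = (scoped d e1 \<and> scoped d e2 \<and> scoped d e3)"
| "prog_scoped d (Seq c1 c2) = (prog_scoped d c1 \<and> prog_scoped d c2)"
| "prog_scoped d Skip = True"
| "prog_scoped d (For e c) = (scoped d e \<and> prog_scoped (Suc d) c)"

text \<open>No entry is negative, so all sign bits are \<open>False\<close> and each entry is an
  arithmetic expression in the triple.\<close>

lemma enc_mat_gen_mat: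
  "enc_mat (gen_mat (u, a, v)) = [False] @ enc_nat (1 + u * a) @ [False] @ enc_nat ((1 + u * a) * v + u) @
     [False] @ enc_nat a @ [False] @ enc_nat (a * v + 1)"
  unfolding gen_mat_eq by (simp add: enc_mat_def enc_int_def del: of_nat_Suc of_nat_add of_nat_mult)

lemma poly_printable_triples:
  "prog_scoped d c \<Longrightarrow> poly_printable d (\<lambda>x st. concat (map (enc_mat \<circ> gen_mat) (triples x st c)))"
proof (induction c arbitrary: d)
  case (Gen e1 e2 e3)
  let ?e = "Add (Const 1) (Mul e1 e2)"
  have "poly_printable d (\<lambda>x st. [False] @ enc_nat (aval x st ?e) @
      [False] @ enc_nat (aval x st (Add (Mul ?e e3) e1)) @ [False] @ enc_nat (aval x st e2) @
      [False] @ enc_nat (aval x st (Add (Mul e2 e3) (Const 1))))"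
    using Gen by (intro poly_printable_append poly_printable_bit poly_printable_enc_nat) auto
  then show ?case by (simp add: enc_mat_gen_mat del: gen_mat.simps)
next
  case (For e c)
  then have "poly_printable d (\<lambda>x st. concat (map (\<lambda>i. concat (map (enc_mat \<circ> gen_mat) (triples x (st @ [i]) c)))
      (rev [0..<aval x st e])))"
    by (intro poly_printable_for) auto
  moreover have "concat (map (enc_mat \<circ> gen_mat) (concat (map g is))) =
      concat (map (\<lambda>i. concat (map (enc_mat \<circ> gen_mat) (g i))) is)" for g and "is" :: "nat list"
    by (induction "is") auto
  ultimately show ?case by (simp only: triples.simps)
qed (auto intro: poly_printable_append poly_printable_Nil)

theorem polytime_computable_instance:
  assumes "scoped 0 e" "prog_scoped 0 c"
  shows "polytime_computable (\<lambda>x. enc_instance (map gen_mat (triples x [] c)) (aval x [] e))"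
proof -
  have "poly_printable 0 (\<lambda>x st. enc_nat (aval x st e) @ concat (map (enc_mat \<circ> gen_mat) (triples x st c)))"
    using assms by (intro poly_printable_append poly_printable_enc_nat poly_printable_triples)
  from polytime_computable_if_printable[OF this] show ?thesis
    by (simp add: enc_instance_def)
qed

section \<open>The reduction\<close>

text \<open>Horner's scheme.\<close>

lemma exists_poly_aexp:
  "\<exists>e. (\<forall>d. scoped d e) \<and> (\<forall>x env. aval x env e = poly (q :: nat poly) (length x))"
proof (induction q)
  case 0
  then show ?case by (intro exI[of _ "Const 0"]) simp
next
  case (pCons c q)
  then obtain e where "\<forall>d. scoped d e" "\<forall>x env. aval x env e = poly q (length x)" by blast
  then show ?case by (intro exI[of _ "Add (Const c) (Mul Len e)"]) simp
qed

fun seqs :: "prog list \<Rightarrow> prog" where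
  "seqs [] = Skip"
| "seqs (c # cs) = Seq c (seqs cs)"

text \<open>A conditional as a loop: with truncated subtraction \<open>1 - (1 - e)\<close> is 1 for
  nonzero \<open>e\<close> and 0 otherwise. The body sees one more variable, whose value is
  0.\<close>

definition guarded :: "aexp \<Rightarrow> prog \<Rightarrow> prog" where
  "guarded e c = For (Sub (Const 1) (Sub (Const 1) e)) c"

lemma set_triples_seqs: "set (triples x env (seqs cs)) = (\<Union>c\<in>set cs. set (triples x env c))"
  by (induction cs) auto

lemma set_triples_For:
  "set (triples x env (For e c)) = (\<Union>i<aval x env e. set (triples x (env @ [i]) c))"
  by auto

lemma set_triples_guarded:
  "set (triples x env (guarded e c)) = (if aval x env e \<noteq> 0 then set (triples x (env @ [0]) c) else {})"
  by (auto simp: guarded_def)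

lemma prog_scoped_seqs: "prog_scoped d (seqs cs) \<longleftrightarrow> (\<forall>c\<in>set cs. prog_scoped d c)"
  by (induction cs) auto

section \<open>The generators of the reduction as a program\<close>

definition n_exp :: "tm \<Rightarrow> aexp \<Rightarrow> aexp" where
  "n_exp M e = Mul e (Const (n_syms M + n_states M))"

definition B_exp :: "tm \<Rightarrow> aexp \<Rightarrow> aexp" where
  "B_exp M e = Add (Mul (Mul (Const 2) (n_exp M e)) (n_exp M e)) (Const 1)"

definition p_exp :: "tm \<Rightarrow> aexp \<Rightarrow> aexp \<Rightarrow> aexp" where
  "p_exp M e j = Add (Add (Const 1) (Mul j (B_exp M e))) (Mul j j)"

definition u_exp :: "tm \<Rightarrow> aexp \<Rightarrow> aexp \<Rightarrow> aexp" where
  "u_exp M e j =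
     Sub (Add (Add (Const 2) (Mul (n_exp M e) (B_exp M e))) (Mul (n_exp M e) (n_exp M e))) (p_exp M e j)"

definition cell_exp :: "tm \<Rightarrow> aexp \<Rightarrow> aexp \<Rightarrow> aexp" where
  "cell_exp M i b = Add (Mul i (Const (n_syms M))) b"

definition control_exp :: "tm \<Rightarrow> aexp \<Rightarrow> aexp \<Rightarrow> nat \<Rightarrow> aexp" where
  "control_exp M e h q = Add (Mul e (Const (n_syms M))) (Add (Mul h (Const (n_states M))) (Const q))"

definition letter_exp :: "tm \<Rightarrow> aexp \<Rightarrow> nat \<Rightarrow> nat \<Rightarrow> aexp" where
  "letter_exp M h q a =
     Add (Const 3) (Add (Mul (Add (Mul h (Const (n_states M))) (Const q)) (Const (n_syms M))) (Const a))"

fun move_exp :: "dir \<Rightarrow> aexp \<Rightarrow> aexp" where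
  "move_exp MoveL h = Sub h (Const 1)"
| "move_exp MoveN h = h"
| "move_exp MoveR h = Add h (Const 1)"

definition start_prog :: "tm \<Rightarrow> aexp \<Rightarrow> prog" where
  "start_prog M e =
     Seq (For e (Gen (Const 1) (Const 1) (p_exp M e (cell_exp M (Var 0) (Input (Var 0))))))
       (Gen (Const 1) (Const 1) (p_exp M e (control_exp M e (Const 0) 0)))"

definition finish_prog :: "tm \<Rightarrow> aexp \<Rightarrow> prog" where
  "finish_prog M e =
     Seq (For e (seqs (map (\<lambda>b. Gen (u_exp M e (cell_exp M (Var 0) (Const b))) (Const 2) (Const 1)) [0..<n_syms M])))
       (For e (Gen (u_exp M e (control_exp M e (Var 0) 2)) (Const 2) (Const 1)))"

text \<open>Variable 0 is the head position and variable 1 another cell.\<close>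

definition letter_prog :: "tm \<Rightarrow> aexp \<Rightarrow> nat \<Rightarrow> nat \<Rightarrow> prog" where
  "letter_prog M e q a = (case tm_next M q a of (q', a', d) \<Rightarrow>
     For e (seqs
      [For e (guarded (Add (Sub (Var 0) (Var 1)) (Sub (Var 1) (Var 0)))
         (seqs (map (\<lambda>b. Gen (u_exp M e (cell_exp M (Var 1) (Const b))) (letter_exp M (Var 0) q a)
            (p_exp M e (cell_exp M (Var 1) (Const b)))) [0..<n_syms M]))),
       Gen (u_exp M e (cell_exp M (Var 0) (Const a))) (letter_exp M (Var 0) q a)
         (p_exp M e (cell_exp M (Var 0) (Const a'))),
       guarded (Sub (Const 1) (Sub (Add (move_exp d (Var 0)) (Const 1)) e))
         (Gen (u_exp M e (control_exp M e (Var 0) q)) (letter_exp M (Var 0) q a)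
            (p_exp M e (control_exp M e (move_exp d (Var 0)) q')))]))"

text \<open>States and symbols belong to the fixed machine and are unrolled into the program text;
  only tape positions, whose number grows with the input, need loops.\<close>

definition tm_prog :: "tm \<Rightarrow> aexp \<Rightarrow> prog" where
  "tm_prog M e = seqs (start_prog M e # finish_prog M e #
     concat (map (\<lambda>q. map (letter_prog M e q) [0..<n_syms M]) (filter (\<lambda>q. q \<noteq> 1 \<and> q \<noteq> 2) [0..<n_states M])))"

lemma scoped_exps:
  "scoped d (cell_exp M i b) \<longleftrightarrow> scoped d i \<and> scoped d b"
  "scoped d (letter_exp M i q a) \<longleftrightarrow> scoped d i"
  "scoped d (move_exp dr i) \<longleftrightarrow> scoped d i"
  by (cases dr; simp add: cell_exp_def letter_exp_def; fail)+

lemma scoped_exps_space: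
  assumes "\<And>d. scoped d e"
  shows "scoped d (p_exp M e j) \<longleftrightarrow> scoped d j" "scoped d (u_exp M e j) \<longleftrightarrow> scoped d j"
    "scoped d (control_exp M e i q) \<longleftrightarrow> scoped d i"
  using assms by (simp_all add: p_exp_def u_exp_def B_exp_def n_exp_def control_exp_def)

lemma prog_scoped_tm_prog:
  assumes "\<And>d. scoped d e"
  shows "prog_scoped 0 (tm_prog M e)"
  using assms
  by (auto simp: tm_prog_def start_prog_def finish_prog_def letter_prog_def guarded_def prog_scoped_seqs
      scoped_exps scoped_exps_space split: prod.split)

lemma aval_move_exp: "aval x env (move_exp d h) = move_head d (aval x env h)"
  by (cases d) auto

context space_bounded_tm
begin

text \<open>The unions are nested like the loops of \<open>tm_prog\<close>: state and symbol, then
  the head position, then another cell and its content.\<close>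

lemma Delta_eq:
  "\<Delta> = (\<Union>q\<in>{..<Q} - {1, 2}. \<Union>a<Y. \<Union>h<m. case tm_next M q a of (q', a', d) \<Rightarrow>
     (\<Union>i<m. if i \<noteq> h then \<Union>b<Y. {(cell i b, letter h q a, cell i b)} else {}) \<union>
     {(cell h a, letter h q a, cell h a')} \<union>
     (if move_head d h < m then {(control h q, letter h q a, control (move_head d h) q')} else {}))"
  (is "_ = ?R")
proof
  show "\<Delta> \<subseteq> ?R"
  proof
    fix t assume "t \<in> \<Delta>"
    moreover obtain i l j where "t = (i, l, j)" by (cases t)
    ultimately have "(i, l, j) \<in> \<Delta>" and t: "t = (i, l, j)" by auto
    from this(1) show "t \<in> ?R"
    proof (cases rule: \<Delta>.cases)
      case (stays i h b q a)
      then show ?thesis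
        unfolding t by - (rule UN_I[of q], simp, rule UN_I[of a], simp, rule UN_I[of h], simp,
          auto split: prod.split)
    next
      case (writes h q a q' a' d)
      then show ?thesis
        unfolding t by - (rule UN_I[of q], simp, rule UN_I[of a], simp, rule UN_I[of h], simp,
          auto split: prod.split)
    next
      case (moves h q a q' a' d)
      then show ?thesis
        unfolding t by - (rule UN_I[of q], simp, rule UN_I[of a], simp, rule UN_I[of h], simp,
          auto split: prod.split)
    qed
  qed
  show "?R \<subseteq> \<Delta>"
    by (auto split: prod.splits if_splits intro: stays writes) (metis moves One_nat_def)
qed

lemma set_triples_tm_prog:
  assumes e: "\<And>env. aval x env e = m"
  shows "set (triples x [] (tm_prog M e)) = T"
proof -
  have aval: "aval x env (p_exp M e j) = p (aval x env j)" "aval x env (u_exp M e j) = N - p (aval x env j)"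
    "aval x env (cell_exp M i b) = cell (aval x env i) (aval x env b)"
    "aval x env (control_exp M e i q) = control (aval x env i) q"
    "aval x env (letter_exp M i q a) = letter (aval x env i) q a" for env i j b q a
    by (simp_all add: p_exp_def u_exp_def B_exp_def n_exp_def cell_exp_def control_exp_def letter_exp_def
        e p_def N_def B_def n_def cell_def control_def letter_def)
  have 1: "set (triples x [] (start_prog M e)) = (\<lambda>j. (1, 1, p j)) ` I"
    unfolding start_prog_def I_def by (auto simp: aval e)
  have 2: "set (triples x [] (finish_prog M e)) = (\<lambda>i. (N - p i, 2, 1)) ` F"
  proof -
    have "F = (\<Union>i<m. \<Union>b<Y. {cell i b}) \<union> (\<Union>h<m. {control h 2})" by (auto simp: F_def)
    then show ?thesis
      unfolding finish_prog_def triples.simps(2) set_append set_triples_For set_triples_seqs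
      by (simp add: aval e image_Un image_UN atLeast0LessThan)
  qed
  let ?f = "\<lambda>(i, a, j). (N - p i, a, p j)"
  have 3: "set (triples x [] (letter_prog M e q a)) = ?f ` (\<Union>h<m. case tm_next M q a of (q', a', d) \<Rightarrow>
     (\<Union>i<m. if i \<noteq> h then \<Union>b<Y. {(cell i b, letter h q a, cell i b)} else {}) \<union>
     {(cell h a, letter h q a, cell h a')} \<union>
     (if move_head d h < m then {(control h q, letter h q a, control (move_head d h) q')} else {}))" for q a
  proof -
    obtain q' a' d where nx: "tm_next M q a = (q', a', d)" by (metis prod_cases3)
    \<comment> \<open>One of the two truncated differences is 0, so their sum is the distance of the
      positions.\<close>
    have ne: "aval x [h, i] (Add (Sub (Var 0) (Var 1)) (Sub (Var 1) (Var 0))) \<noteq> 0 \<longleftrightarrow> i \<noteq> h" for h i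
      by auto
    \<comment> \<open>The outer difference is 1 if the new position lies below \<open>m\<close> and
      0 otherwise.\<close>
    have less: "aval x [h] (Sub (Const 1) (Sub (Add (move_exp d (Var 0)) (Const 1)) e)) \<noteq> 0 \<longleftrightarrow> move_head d h < m" for h
      by (auto simp: aval_move_exp e)
    show ?thesis
      unfolding letter_prog_def nx prod.case set_triples_For set_triples_seqs list.set UN_insert UN_empty
        set_triples_guarded append_Nil append_Cons ne less
      by (simp add: aval aval_move_exp e image_Un image_UN if_distrib[of "image ?f"] Un_assoc
          atLeast0LessThan cong: if_cong)
  qed
  have "set (triples x [] (tm_prog M e)) = (\<lambda>j. (1, 1, p j)) ` I \<union> (\<lambda>i. (N - p i, 2, 1)) ` F \<union>
      (\<Union>q\<in>{..<Q} - {1, 2}. \<Union>a<Y. set (triples x [] (letter_prog M e q a)))"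
    unfolding tm_prog_def set_triples_seqs by (auto simp: 1 2 atLeast0LessThan)
  also have "\<dots> = T"
    unfolding T_def unfolding 3 Delta_eq by (simp only: image_UN Un_ac)
  finally show ?thesis .
qed

text \<open>Encodings are injective, so membership of this string concerns this one instance; its
  bound is positive by \<open>m_pos\<close>.\<close>

lemma instance_in_problem_iff:
  assumes "\<And>env. aval x env e = m"
  shows "enc_instance (map gen_mat (triples x [] (tm_prog M e))) m \<in> k_freeness_problem \<longleftrightarrow> (\<nexists>t. state t = 2)"
proof -
  have "set (map gen_mat (triples x [] (tm_prog M e))) = gen_mat ` T"
    using set_triples_tm_prog[OF assms] by simp
  moreover have "gen_mat ` T \<subseteq> SL2Z" by (auto simp: SL2Z_def det_gen_mat simp del: gen_mat.simps)
  ultimately show ?thesis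
    using k_free_iff_not_reject m_pos by (auto simp: k_freeness_problem_def enc_instance_eq_iff)
qed

end

theorem theorem7: "PSPACE_hard k_freeness_problem"
  unfolding PSPACE_hard_def
proof
  fix A assume "A \<in> PSPACE"
  then obtain M and q :: "nat poly" where M: "wf_tm M" "n_tapes M = 1" "decides_in_space M A (poly q)"
    unfolding PSPACE_def by blast
  obtain e where e: "\<And>d. scoped d e" "\<And>x env. aval x env e = poly q (length x)"
    using exists_poly_aexp by blast
  let ?f = "\<lambda>x. enc_instance (map gen_mat (triples x [] (tm_prog M e))) (aval x [] e)"
  have "x \<in> A \<longleftrightarrow> ?f x \<in> k_freeness_problem" for x
  proof -
    interpret space_bounded_tm M x "poly q (length x)"
    proof
      show "wf_tm M" "n_tapes M = 1" by (fact M)+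
      show "h < poly q (length x)" if "(c, h) \<in> set (snd (tm_run M x t))" for t c h
        using M(3) that unfolding decides_in_space_def by blast
    qed
    obtain t where t: "state t = (if x \<in> A then 1 else 2)"
      using M(3) unfolding decides_in_space_def state_def by blast
    \<comment> \<open>The machine reaches a halting state on every input and stays in it, so
      accepting is the same as never rejecting.\<close>
    have "x \<in> A \<longleftrightarrow> (\<nexists>t. state t = 2)"
    proof
      assume "x \<in> A"
      then have t: "state t = 1" using t by simp
      show "\<nexists>t. state t = 2"
      proof
        assume "\<exists>t. state t = 2"
        then obtain s where s: "state s = 2" by blast
        show False
          using state_absorbing[of t "s - t"] state_absorbing[of s "t - s"] t s
          by (cases "s \<le> t") auto
      qed
    next
      assume "\<nexists>t. state t = 2"
      then show "x \<in> A" using t by metis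
    qed
    then show ?thesis using instance_in_problem_iff[of e] e(2) by simp
  qed
  moreover have "polytime_computable ?f"
    using e(1) prog_scoped_tm_prog by (intro polytime_computable_instance) blast+
  ultimately show "polytime_reducible A k_freeness_problem"
    unfolding polytime_reducible_def by blast
qed

end
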